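(* Let $X$ and $Y$ be Banach spaces that are Lipschitz isomorphic, i.e. there is a bijection $U:Y\to X$ such that $U$ and $U^{-1}$ are Lipschitz. If $Y$ is linearly isomorphic to a (closed linear) subspace of $c_0(\mathbb N)$, then $X$ is linearly isomorphic to a subspace of $c_0(\mathbb N)$.
   Context: Here $c_0(\mathbb N)$ denotes the Banach space of real null sequences with the supremum norm. *)

theory Defs
  imports "HOL-Analysis.Analysis"
begin

definition c0 :: "(nat \<Rightarrow> real) set" where
  "c0 = {f. f \<longlonglongrightarrow> 0}"

definition c0_norm :: "(nat \<Rightarrow> real) \<Rightarrow> real" where
  "c0_norm f = (SUP n. \<bar>f n\<bar>)"

definition c0_embedding :: "('a::real_normed_vector \<Rightarrow> nat \<Rightarrow> real) \<Rightarrow> bool" where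
  "c0_embedding T \<longleftrightarrow>
     (\<forall>x. T x \<in> c0) \<and>
     (\<forall>x y. T (x + y) = (\<lambda>n. T x n + T y n)) \<and>
     (\<forall>c x. T (c *\<^sub>R x) = (\<lambda>n. c * T x n)) \<and>
     (\<exists>a b. 0 < a \<and> 0 < b \<and>
        (\<forall>x. a * norm x \<le> c0_norm (T x) \<and> c0_norm (T x) \<le> b * norm x))"

definition isomorphic_to_subspace_of_c0 :: "'a::real_normed_vector itself \<Rightarrow> bool" where
  "isomorphic_to_subspace_of_c0 _ \<longleftrightarrow> (\<exists>T :: 'a \<Rightarrow> nat \<Rightarrow> real. c0_embedding T)"

end

theory Submission
  imports Defs
begin

text \<open>
  Give \<open>Y\<close> the norm inherited from \<open>c\<^sub>0\<close> and norm a functional \<open>f\<close> on \<open>X\<close> by the Lipschitz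
  constant of \<open>f \<circ> U\<close>. Gorelik's principle, a consequence of Brouwer's fixed point theorem, shows
  that \<open>\<parallel>p + v\<parallel> \<ge> \<parallel>p\<parallel> + c \<parallel>v\<parallel> - \<eta>\<close> whenever \<open>v\<close> is bounded and weak-star close to \<open>0\<close> (Godefroy,
  Kalton and Lancien). By weak-star compactness every functional then splits into a sum of
  increments with bounded total norm, the \<open>j\<close>-th of which is taken from a finite set of functionals
  that are small at the first \<open>j\<close> points of a dense sequence. The normalised increments form a
  weak-star null norming sequence, which is the desired embedding into \<open>c\<^sub>0\<close>.
\<close>

subsection \<open>The fixed point property of the Hilbert cube\<close>

text \<open>\<open>U\<close> has no adjoint, so a functional \<open>f\<close> on X is visible to Y
  only through the nonlinear \<open>f o U\<close>, and the finite-codimensional subspaces of Y on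
  which c0 behaves well have no linear images in X. Gorelik's principle bridges this: the image of
  such a subspace, moved to a midpoint, still meets every small translate of a certain compact set,
  up to a small error. The compact set has to be fixed before the translation, since the translation
  depends on the functional being tested and the weak-star neighbourhood may not.

  The constant is c = 1 / (3 K^2), where \<open>K\<close> bounds both Lipschitz constants. A pair in
  Y at distance s that norms \<open>v\<close> gives a vector of norm at most K s in X, and
  translating by x in X moves points of Y by at most K |x|; this costs K^2. The factor 3 arises
  because the size of the compact set, the displacement and the error together must not exceed half
  the distance of the pair that norms \<open>p\<close>.

  That \<open>p\<close> enters the inequality with coefficient 1 is what lets the norms of the
  increments telescope.\<close>

lemma compact_Pi_UNIV:
  fixes S :: "'i \<Rightarrow> 'b::topological_space set"
  assumes "\<And>i. compact (S i)"
  shows "compact {x. \<forall>i. x i \<in> S i}"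
proof -
  have "compactin (product_topology (\<lambda>i. euclidean) UNIV) (PiE UNIV S)"
    unfolding compactin_PiE using assms by simp
  then show ?thesis
    by (simp add: euclidean_product_topology PiE_UNIV_domain Pi_def)
qed

lemma tendsto_fun_iff:
  fixes f :: "'c \<Rightarrow> 'i \<Rightarrow> 'b::topological_space"
  shows "(f \<longlongrightarrow> l) F \<longleftrightarrow> (\<forall>i. ((\<lambda>c. f c i) \<longlongrightarrow> l i) F)"
  using limitin_componentwise[of "\<lambda>i::'i. (euclidean::'b topology)" UNIV f l F]
  by (simp add: euclidean_product_topology)

text \<open>Infinitely many coordinates serve all dimensions at once: the dimension needed below is
  the size of a finite net that arises inside a proof.\<close>

definition hilbert_cube :: "(nat \<Rightarrow> real) set" where
  "hilbert_cube = {x. \<forall>i. x i \<in> {0..1}}"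

text \<open>\<open>p\<close> is both the number of coordinates kept and the number of grid steps per
  edge. Kuhn's combinatorial lemma yields a cell in which every label takes both values. A label
  records the direction in which \<open>f\<close> moves a coordinate; its forced values on the faces
  are consistent with that because \<open>f\<close> stays in the cube.\<close>

lemma hilbert_cube_approximate_fixpoint:
  assumes f: "f \<in> hilbert_cube \<rightarrow> hilbert_cube"
  shows "\<exists>q\<in>hilbert_cube. \<forall>i\<le>k. \<exists>r\<in>hilbert_cube. \<exists>s\<in>hilbert_cube.
    (\<forall>j. \<bar>r j - q j\<bar> \<le> 1 / Suc k) \<and> (\<forall>j. \<bar>s j - q j\<bar> \<le> 1 / Suc k) \<and> r i \<le> f r i \<and> f s i \<le> s i"
proof -
  define p where "p = Suc k"
  define emb where "emb = (\<lambda>(x::nat\<Rightarrow>nat) i. if i < p then real (x i) / real p else 0)"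
  define label where "label = (\<lambda>x i. if x i = p \<or> x i \<noteq> 0 \<and> f (emb x) i < emb x i then 1 else 0::nat)"
  have p: "p > 0" by (simp add: p_def)
  have emb: "emb x \<in> hilbert_cube" if "\<forall>i<p. x i \<le> p" for x
    using that p by (auto simp: emb_def hilbert_cube_def)
  obtain q where q: "\<forall>i<p. q i < p"
    and rs: "\<forall>i<p. \<exists>r s. (\<forall>j<p. q j \<le> r j \<and> r j \<le> q j + 1) \<and>
        (\<forall>j<p. q j \<le> s j \<and> s j \<le> q j + 1) \<and> label r i \<noteq> label s i"
    by (rule kuhn_lemma[of p p label]) (use p in \<open>auto simp: label_def\<close>)
  have near: "\<bar>emb r j - emb q j\<bar> \<le> 1 / Suc k" if "\<forall>j<p. q j \<le> r j \<and> r j \<le> q j + 1" for r j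
  proof (cases "j < p")
    case True
    then have "\<bar>real (r j) - real (q j)\<bar> \<le> 1" using that by force
    then show ?thesis using True
      by (simp add: emb_def p_def divide_right_mono flip: diff_divide_distrib)
  qed (simp add: emb_def)
  have dir: "(label r i = 0 \<longrightarrow> emb r i \<le> f (emb r) i) \<and> (label r i \<noteq> 0 \<longrightarrow> f (emb r) i \<le> emb r i)"
    if "\<forall>j<p. q j \<le> r j \<and> r j \<le> q j + 1" "i < p" for r i
  proof -
    have "emb r \<in> hilbert_cube" using that q by (intro emb) force
    then have "f (emb r) \<in> hilbert_cube" using f by blast
    then have "0 \<le> f (emb r) i" "f (emb r) i \<le> 1" by (auto simp: hilbert_cube_def)
    then show ?thesis using that p by (auto simp: label_def emb_def split: if_splits)
  qed
  have cube: "emb r \<in> hilbert_cube" if "\<forall>j<p. q j \<le> r j \<and> r j \<le> q j + 1" for r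
    using that q by (intro emb) force
  have "\<exists>r\<in>hilbert_cube. \<exists>s\<in>hilbert_cube. (\<forall>j. \<bar>r j - emb q j\<bar> \<le> 1 / Suc k) \<and>
        (\<forall>j. \<bar>s j - emb q j\<bar> \<le> 1 / Suc k) \<and> r i \<le> f r i \<and> f s i \<le> s i" if "i \<le> k" for i
  proof -
    from that
    have i: "i < p" by (simp add: p_def)
    then obtain r s where r: "\<forall>j<p. q j \<le> r j \<and> r j \<le> q j + 1"
      and s: "\<forall>j<p. q j \<le> s j \<and> s j \<le> q j + 1" and l: "label r i \<noteq> label s i"
      using rs by blast
    show ?thesis
    proof (cases "label r i = 0")
      case True
      then show ?thesis using cube[OF r] cube[OF s] near[OF r] near[OF s] dir[OF r i] dir[OF s i] l
        by (intro bexI[of _ "emb r"] bexI[of _ "emb s"]) auto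
    next
      case False
      then have "label s i = 0" using l by (auto simp: label_def split: if_splits)
      then show ?thesis using False cube[OF r] cube[OF s] near[OF r] near[OF s] dir[OF r i] dir[OF s i]
        by (intro bexI[of _ "emb s"] bexI[of _ "emb r"]) auto
    qed
  qed
  then show ?thesis using cube[of q] by auto
qed

theorem hilbert_cube_fixpoint:
  assumes cont: "continuous_on hilbert_cube f" and f: "f \<in> hilbert_cube \<rightarrow> hilbert_cube"
  obtains x where "x \<in> hilbert_cube" "f x = x"
proof -
  obtain q where q: "\<And>k. q k \<in> hilbert_cube"
    and qrs: "\<And>k i. i \<le> k \<Longrightarrow> \<exists>r\<in>hilbert_cube. \<exists>s\<in>hilbert_cube.
      (\<forall>j. \<bar>r j - q k j\<bar> \<le> 1 / Suc k) \<and> (\<forall>j. \<bar>s j - q k j\<bar> \<le> 1 / Suc k) \<and> r i \<le> f r i \<and> f s i \<le> s i"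
    using hilbert_cube_approximate_fixpoint[OF f] by metis
  have "compact hilbert_cube" unfolding hilbert_cube_def by (rule compact_Pi_UNIV) simp
  then obtain l \<sigma> where l: "l \<in> hilbert_cube" and \<sigma>: "strict_mono (\<sigma>::nat\<Rightarrow>nat)" and lim: "(q \<circ> \<sigma>) \<longlonglongrightarrow> l"
    unfolding compact_def using q by blast
  have lim_near: "(\<lambda>k. f (r (\<sigma> k)) i) \<longlonglongrightarrow> f l i \<and> (\<lambda>k. r (\<sigma> k) i) \<longlonglongrightarrow> l i"
    if r: "\<And>k. r k \<in> hilbert_cube" "\<And>k j. k \<ge> i \<Longrightarrow> \<bar>r k j - q k j\<bar> \<le> 1 / Suc k" for r i
  proof -
    have "(\<lambda>k. r (\<sigma> k) j - q (\<sigma> k) j) \<longlonglongrightarrow> 0" for j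
    proof (rule Lim_null_comparison)
      show "\<forall>\<^sub>F k in sequentially. norm (r (\<sigma> k) j - q (\<sigma> k) j) \<le> 1 / Suc k"
      proof (rule eventually_sequentiallyI)
        fix k assume "i \<le> k"
        then have "i \<le> \<sigma> k" and k: "k \<le> \<sigma> k" using seq_suble[OF \<sigma>, of k] by auto
        then have "\<bar>r (\<sigma> k) j - q (\<sigma> k) j\<bar> \<le> 1 / Suc (\<sigma> k)" by (intro r)
        also have "\<dots> \<le> 1 / Suc k" using k by (intro divide_left_mono) auto
        finally show "norm (r (\<sigma> k) j - q (\<sigma> k) j) \<le> 1 / Suc k" by simp
      qed
    qed (rule LIMSEQ_Suc[OF lim_1_over_n])
    then have "(\<lambda>k. (r (\<sigma> k) j - q (\<sigma> k) j) + q (\<sigma> k) j) \<longlonglongrightarrow> 0 + l j" for j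
      using lim by (intro tendsto_add) (auto simp: tendsto_fun_iff)
    then have r_lim: "(\<lambda>k. r (\<sigma> k)) \<longlonglongrightarrow> l" by (simp add: tendsto_fun_iff)
    moreover from continuous_on_tendsto_compose[OF cont r_lim l] r(1)
    have "(\<lambda>k. f (r (\<sigma> k))) \<longlonglongrightarrow> f l" by simp
    ultimately show ?thesis by (simp add: tendsto_fun_iff)
  qed
  \<comment> \<open>For fixed \<open>i\<close> the witnesses of either inequality converge to the
    same \<open>l\<close>, so both inequalities pass to the limit.\<close>
  have "f l i = l i" for i
  proof (rule antisym)
    obtain r where r: "\<And>k. r k \<in> hilbert_cube" "\<And>k j. k \<ge> i \<Longrightarrow> \<bar>r k j - q k j\<bar> \<le> 1 / Suc k"
      "\<And>k. k \<ge> i \<Longrightarrow> r k i \<le> f (r k) i"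
      using bchoice[of UNIV "\<lambda>k r. r \<in> hilbert_cube \<and>
        (k \<ge> i \<longrightarrow> (\<forall>j. \<bar>r j - q k j\<bar> \<le> 1 / Suc k) \<and> r i \<le> f r i)"] qrs[of i] q by auto blast+
    show "l i \<le> f l i"
    proof (rule LIMSEQ_le)
      show "\<exists>N. \<forall>k\<ge>N. r (\<sigma> k) i \<le> f (r (\<sigma> k)) i"
        using r(3) seq_suble[OF \<sigma>] order_trans by blast
    qed (use lim_near[OF r(1,2)] in auto)
    obtain s where s: "\<And>k. s k \<in> hilbert_cube" "\<And>k j. k \<ge> i \<Longrightarrow> \<bar>s k j - q k j\<bar> \<le> 1 / Suc k"
      "\<And>k. k \<ge> i \<Longrightarrow> f (s k) i \<le> s k i"
      using bchoice[of UNIV "\<lambda>k r. r \<in> hilbert_cube \<and>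
        (k \<ge> i \<longrightarrow> (\<forall>j. \<bar>r j - q k j\<bar> \<le> 1 / Suc k) \<and> f r i \<le> r i)"] qrs[of i] q by auto blast+
    show "f l i \<le> l i"
    proof (rule LIMSEQ_le)
      show "\<exists>N. \<forall>k\<ge>N. f (s (\<sigma> k)) i \<le> s (\<sigma> k) i"
        using s(3) seq_suble[OF \<sigma>] order_trans by blast
    qed (use lim_near[OF s(1,2)] in auto)
  qed
  then show thesis using that l by blast
qed

subsection \<open>Norming functionals\<close>

definition sublinear :: "('a::real_vector \<Rightarrow> real) \<Rightarrow> bool" where
  "sublinear p \<longleftrightarrow> (\<forall>x y. p (x + y) \<le> p x + p y) \<and> (\<forall>c x. 0 \<le> c \<longrightarrow> p (c *\<^sub>R x) = c * p x)"

text \<open>For sublinear \<open>p\<close> this is the largest sublinear \<open>q \<le> p\<close>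
  with \<open>q (- a) \<le> - p a\<close> (take t = 1), so a linear functional below it agrees with
  \<open>p\<close> at \<open>a\<close>.\<close>

definition sublinear_shift :: "('a::real_vector \<Rightarrow> real) \<Rightarrow> 'a \<Rightarrow> 'a \<Rightarrow> real" where
  "sublinear_shift p a x = (INF t\<in>{0..}. p (x + t *\<^sub>R a) - t * p a)"

lemma sublinear_neg_le:
  assumes "sublinear p"
  shows "- p (- x) \<le> p x"
proof -
  have "p (x + - x) \<le> p x + p (- x)" "p (0 *\<^sub>R x) = 0 * p x"
    using assms unfolding sublinear_def by blast+
  then show ?thesis by simp
qed

text \<open>A bound independent of t, without which the infimum in \<open>sublinear_shift\<close>
  would carry no information.\<close>

lemma sublinear_shift_lower:
  assumes p: "sublinear p" and t: "t \<ge> 0"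
  shows "- p (- x) \<le> p (x + t *\<^sub>R a) - t * p a"
proof -
  have "p (t *\<^sub>R a) = t * p a" using p t by (simp add: sublinear_def)
  moreover have "p (- x + (x + t *\<^sub>R a)) \<le> p (- x) + p (x + t *\<^sub>R a)"
    using p unfolding sublinear_def by blast
  ultimately show ?thesis by simp
qed

lemma sublinear_shift_le:
  assumes "sublinear p" "t \<ge> 0"
  shows "sublinear_shift p a x \<le> p (x + t *\<^sub>R a) - t * p a"
  unfolding sublinear_shift_def using assms sublinear_shift_lower[OF assms(1)]
  by (intro cINF_lower) (auto intro!: bdd_belowI2[where m = "- p (- x)"])

lemma le_sublinear_shift:
  assumes "\<And>t. t \<ge> 0 \<Longrightarrow> b \<le> p (x + t *\<^sub>R a) - t * p a"
  shows "b \<le> sublinear_shift p a x"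
  unfolding sublinear_shift_def using assms by (intro cINF_greatest) auto

lemma sublinear_sublinear_shift:
  assumes p: "sublinear p"
  shows "sublinear (sublinear_shift p a)"
proof -
  let ?q = "sublinear_shift p a"
  have add: "?q (x + y) \<le> ?q x + ?q y" for x y
  proof -
    have "?q (x + y) - (p (y + u *\<^sub>R a) - u * p a) \<le> p (x + t *\<^sub>R a) - t * p a"
      if "t \<ge> 0" "u \<ge> 0" for t u
    proof -
      have "?q (x + y) \<le> p ((x + y) + (t + u) *\<^sub>R a) - (t + u) * p a"
        using that by (intro sublinear_shift_le p) simp
      also have "(x + y) + (t + u) *\<^sub>R a = (x + t *\<^sub>R a) + (y + u *\<^sub>R a)"
        by (simp add: algebra_simps)
      also have "p \<dots> \<le> p (x + t *\<^sub>R a) + p (y + u *\<^sub>R a)" using p unfolding sublinear_def by blast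
      finally show ?thesis by (simp add: algebra_simps)
    qed
    then have "?q (x + y) - (p (y + u *\<^sub>R a) - u * p a) \<le> ?q x" if "u \<ge> 0" for u
      using that by (intro le_sublinear_shift) auto
    then have "?q (x + y) - ?q x \<le> ?q y"
      by (intro le_sublinear_shift) (auto simp: algebra_simps)
    then show ?thesis by simp
  qed
  have le: "?q (c *\<^sub>R x) \<le> c * ?q x" if c: "c > 0" for c x
  proof -
    have "?q (c *\<^sub>R x) / c \<le> p (x + t *\<^sub>R a) - t * p a" if "t \<ge> 0" for t
    proof -
      have "?q (c *\<^sub>R x) \<le> p (c *\<^sub>R x + (c * t) *\<^sub>R a) - (c * t) * p a"
        using c that by (intro sublinear_shift_le p) simp
      also have "c *\<^sub>R x + (c * t) *\<^sub>R a = c *\<^sub>R (x + t *\<^sub>R a)" by (simp add: algebra_simps)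
      also have "p \<dots> = c * p (x + t *\<^sub>R a)" using p c by (simp add: sublinear_def)
      finally show ?thesis using c by (simp add: field_simps)
    qed
    then have "?q (c *\<^sub>R x) / c \<le> ?q x" by (rule le_sublinear_shift)
    then show ?thesis using c by (simp add: field_simps)
  qed
  have "?q (c *\<^sub>R x) = c * ?q x" if "c \<ge> 0" for c x
  proof (cases "c = 0")
    case True
    have "p (0 *\<^sub>R a) = 0 * p a" using p unfolding sublinear_def by blast
    then have p0: "p 0 = 0" by simp
    have "p (t *\<^sub>R a) = t * p a" if "t \<ge> 0" for t using p that by (simp add: sublinear_def)
    then have "0 \<le> ?q 0" by (intro le_sublinear_shift) simp
    moreover have "?q 0 \<le> 0" using sublinear_shift_le[OF p, of 0 a 0] p0 by simp
    ultimately show ?thesis using True by simp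
  next
    case False
    then have c: "c > 0" using that by simp
    \<comment> \<open>The opposite inequality is \<open>le\<close> again, for the factor 1 /
      c.\<close>
    have "?q ((1 / c) *\<^sub>R (c *\<^sub>R x)) \<le> 1 / c * ?q (c *\<^sub>R x)" using c by (intro le) simp
    then have "c * ?q x \<le> ?q (c *\<^sub>R x)" using c by (simp add: field_simps)
    then show ?thesis using le[OF c, of x] by simp
  qed
  then show ?thesis using add by (simp add: sublinear_def)
qed

text \<open>A sublinear functional which is minimal among all sublinear functionals is linear, because
  it cannot be decreased by any shift.\<close>

theorem linear_below_sublinear:
  fixes p :: "'a::real_vector \<Rightarrow> real"
  assumes p: "sublinear p"
  obtains f where "linear f" "\<And>x. f x \<le> p x"
proof -
  define A where "A = {q. sublinear q \<and> q \<le> p}"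
  \<comment> \<open>The order is reversed, so the maximal element given by Zorn's lemma is a minimal
    functional.\<close>
  define P where "P = (\<lambda>q r :: 'a \<Rightarrow> real. r \<le> q)"
  have "\<exists>m\<in>A. \<forall>q\<in>A. P m q \<longrightarrow> q = m"
  proof (rule predicate_Zorn)
    show "partial_order_on A (relation_of P A)"
      by (rule partial_order_on_relation_ofI) (auto simp: P_def)
    fix C assume C: "C \<in> Chains (relation_of P A)"
    then have CA: "C \<subseteq> A" and tot: "\<And>q r. q \<in> C \<Longrightarrow> r \<in> C \<Longrightarrow> q \<le> r \<or> r \<le> q"
      unfolding Chains_def relation_of_def P_def by auto
    show "\<exists>u\<in>A. \<forall>q\<in>C. P q u"
    proof (cases "C = {}")
      case True
      then show ?thesis using p by (auto simp: A_def)
    next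
      case False
      define u where "u = (\<lambda>x. INF q\<in>C. q x)"
      have low: "- p (- x) \<le> q x" if "q \<in> C" for q x
      proof -
        have "q (- x) \<le> p (- x)" "sublinear q" using that CA by (auto simp: A_def le_fun_def)
        then show ?thesis using sublinear_neg_le[of q x] by linarith
      qed
      have u_le: "u x \<le> q x" if "q \<in> C" for q x
        unfolding u_def using that low by (intro cINF_lower) (auto intro!: bdd_belowI2)
      have le_u: "b \<le> u x" if "\<And>q. q \<in> C \<Longrightarrow> b \<le> q x" for b x
        unfolding u_def using that False by (intro cINF_greatest) auto
      have add: "u (x + y) \<le> u x + u y" for x y
      proof -
        have "u (x + y) - r y \<le> q x" if qr: "q \<in> C" "r \<in> C" for q r
        proof -
          \<comment> \<open>Along a chain the smaller of \<open>q\<close> and \<open>r\<close>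
            bounds both summands at once; this makes the pointwise infimum subadditive.\<close>
          obtain s where s: "s \<in> C" "s \<le> q" "s \<le> r" using tot[OF qr] qr by blast
          then have "u (x + y) \<le> s (x + y)" using u_le by blast
          also have "\<dots> \<le> s x + s y" using s CA by (auto simp: A_def sublinear_def)
          also have "\<dots> \<le> q x + r y" using s by (auto simp: le_fun_def intro: add_mono)
          finally show ?thesis by simp
        qed
        then have "u (x + y) - r y \<le> u x" if "r \<in> C" for r using that by (intro le_u)
        then have "u (x + y) - u x \<le> u y" by (intro le_u) (auto simp: algebra_simps)
        then show ?thesis by simp
      qed
      have sc: "u (c *\<^sub>R x) = c * u x" if c: "c \<ge> 0" for c x
      proof -
        have eq: "q (c *\<^sub>R x) = c * q x" if "q \<in> C" for q
          using that CA c by (auto simp: A_def sublinear_def)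
        show ?thesis
        proof (cases "c = 0")
          case True
          then have "(\<lambda>q. q (c *\<^sub>R x)) ` C = {0}" using eq False by force
          then show ?thesis using True by (simp add: u_def)
        next
          case False
          then have c: "c > 0" using c by simp
          have "u (c *\<^sub>R x) / c \<le> u x"
            using u_le[of _ "c *\<^sub>R x"] eq c by (intro le_u) (simp add: field_simps)
          moreover have "c * u x \<le> u (c *\<^sub>R x)"
            using u_le[of _ x] c by (intro le_u) (simp add: eq)
          ultimately show ?thesis using c by (simp add: field_simps)
        qed
      qed
      obtain q where q: "q \<in> C" using False by blast
      then have "q \<le> p" using CA by (auto simp: A_def)
      then have "u \<le> p" using u_le[OF q] by (meson le_fun_def order_trans)
      then have "u \<in> A" using add sc by (simp add: A_def sublinear_def)
      then show ?thesis using u_le by (auto simp: P_def le_fun_def)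
    qed
  qed
  then obtain f where f: "sublinear f" "f \<le> p" and min: "\<And>q. sublinear q \<Longrightarrow> q \<le> f \<Longrightarrow> q = f"
    unfolding A_def P_def by (smt (verit) mem_Collect_eq order_trans)
  \<comment> \<open>t = 0 puts the shift below \<open>f\<close>, so minimality gives equality; t = 1
    then gives superadditivity.\<close>
  have "sublinear_shift f a = f" for a
    using sublinear_shift_le[OF f(1), of 0]
    by (intro min sublinear_sublinear_shift f) (simp add: le_fun_def)
  then have "f x \<le> f (x + a) - f a" for x a
    using sublinear_shift_le[OF f(1), of 1 a x] by simp
  then have add: "f (x + a) = f x + f a" for x a
    using f(1) by (simp add: sublinear_def eq_iff algebra_simps)
  have neg: "f (- x) = - f x" for x
    using add[of x "- x"] f(1)[unfolded sublinear_def, THEN conjunct2, rule_format, of 0 0] by simp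
  have "f (c *\<^sub>R x) = c * f x" for c x
  proof (cases "c \<ge> 0")
    case False
    then have "f ((- c) *\<^sub>R x) = - c * f x"
      using f(1)[unfolded sublinear_def, THEN conjunct2, rule_format, of "- c" x] by linarith
    then show ?thesis using neg[of "c *\<^sub>R x"] by simp
  qed (use f in \<open>simp add: sublinear_def\<close>)
  then have "linear f" using add by (intro linearI) auto
  then show thesis using that f(2) by (simp add: le_fun_def)
qed

text \<open>Shifting the norm along \<open>x\<close> replaces an extension from the line through
  \<open>x\<close>: it forces the value at \<open>- x\<close> down to
  \<open>- norm x\<close>.\<close>

corollary norming_functional:
  fixes x :: "'a::real_normed_vector"
  obtains f :: "'a \<Rightarrow> real" where "linear f" "\<And>y. \<bar>f y\<bar> \<le> norm y" "f x = norm x"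
proof -
  have n: "sublinear (norm :: 'a \<Rightarrow> real)" by (simp add: sublinear_def norm_triangle_ineq)
  obtain f where f: "linear f" "\<And>y. f y \<le> sublinear_shift norm x y"
    using linear_below_sublinear[OF sublinear_sublinear_shift[OF n]] by blast
  have le: "f y \<le> norm y" for y
    using f(2)[of y] sublinear_shift_le[OF n, of 0 x y] by simp
  have "f (- x) \<le> - norm x"
    using f(2)[of "- x"] sublinear_shift_le[OF n, of 1 x "- x"] by simp
  then have "f x = norm x" using le[of x] by (simp add: linear_neg[OF f(1)])
  moreover have "\<bar>f y\<bar> \<le> norm y" for y
    using le[of y] le[of "- y"] by (simp add: linear_neg[OF f(1)] abs_le_iff)
  ultimately show thesis using that f(1) by blast
qed

subsection \<open>Gorelik's principle in subspaces of \<open>c\<^sub>0\<close>\<close>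

locale c0_subspace =
  fixes T :: "'b::real_normed_vector \<Rightarrow> nat \<Rightarrow> real"
  assumes embedding: "c0_embedding T"
begin

abbreviation nrm :: "'b \<Rightarrow> real" where
  "nrm y \<equiv> c0_norm (T y)"

lemma T_tendsto: "T y \<longlonglongrightarrow> 0"
  using embedding by (auto simp: c0_embedding_def c0_def)

lemma T_add: "T (x + y) i = T x i + T y i"
  and T_scaleR: "T (c *\<^sub>R x) i = c * T x i"
  using embedding by (auto simp: c0_embedding_def)

lemma linear_T: "linear (\<lambda>y. T y i)"
  by (rule linearI) (simp_all add: T_add T_scaleR)

lemmas T_diff = linear_diff[OF linear_T]
  and T_minus = linear_neg[OF linear_T]
  and T_zero [simp] = linear_0[OF linear_T]
  and T_sum = linear_sum[OF linear_T]

lemma T_le_nrm: "\<bar>T y i\<bar> \<le> nrm y"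
proof -
  have "Bseq (T y)" using T_tendsto convergent_def convergent_imp_Bseq by blast
  then obtain K where "\<And>n. \<bar>T y n\<bar> \<le> K" by (auto simp: Bseq_def)
  then show ?thesis unfolding c0_norm_def by (intro cSUP_upper) (auto intro!: bdd_aboveI2)
qed

lemma nrm_le: "(\<And>i. \<bar>T y i\<bar> \<le> r) \<Longrightarrow> nrm y \<le> r"
  unfolding c0_norm_def by (intro cSUP_least) auto

lemma nrm_nonneg [simp]: "0 \<le> nrm y"
  using T_le_nrm[of y 0] by linarith

lemma nrm_triangle: "nrm (x + y) \<le> nrm x + nrm y"
proof (rule nrm_le)
  fix i
  show "\<bar>T (x + y) i\<bar> \<le> nrm x + nrm y"
    using T_le_nrm[of x i] T_le_nrm[of y i] by (simp add: T_add)
qed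

lemma nrm_minus: "nrm (- x) = nrm x"
  by (simp add: c0_norm_def T_minus)

lemma nrm_minus_commute: "nrm (x - y) = nrm (y - x)"
  using nrm_minus[of "x - y"] by simp

lemma nrm_scaleR_le: "nrm (c *\<^sub>R x) \<le> \<bar>c\<bar> * nrm x"
  using T_le_nrm[of x] by (intro nrm_le) (simp add: T_scaleR abs_mult mult_left_mono)

text \<open>The feature of c0 that drives the proof: vectors with almost disjoint supports combine
  by maximum, not by sum.\<close>

lemma nrm_add_tail_le:
  assumes "\<And>i. i \<ge> n \<Longrightarrow> \<bar>T h i\<bar> \<le> e" "\<And>i. i < n \<Longrightarrow> T z i = 0" "nrm h \<le> r" "nrm z \<le> r" "e \<ge> 0"
  shows "nrm (h + z) \<le> r + e"
proof (rule nrm_le)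
  fix i
  show "\<bar>T (h + z) i\<bar> \<le> r + e"
    using assms(1,2)[of i] T_le_nrm[of h i] T_le_nrm[of z i] assms(3-5)
    by (cases "i < n") (auto simp: T_add)
qed

lemma nrm_bounds:
  obtains a b where "0 < a" "0 < b" "\<And>y. a * norm y \<le> nrm y" "\<And>y. nrm y \<le> b * norm y"
  using embedding by (auto simp: c0_embedding_def)

lemma nrm_zero [simp]: "nrm 0 = 0"
  by (simp add: c0_norm_def)

lemma nrm_pos: "y \<noteq> 0 \<Longrightarrow> 0 < nrm y"
proof -
  assume "y \<noteq> 0"
  obtain a where "0 < a" "a * norm y \<le> nrm y" using nrm_bounds by metis
  moreover have "0 < a * norm y" using \<open>0 < a\<close> \<open>y \<noteq> 0\<close> by simp
  ultimately show ?thesis by linarith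
qed

lemma continuous_on_T: "continuous_on S (\<lambda>y. T y i)"
proof -
  obtain b where b: "\<And>y. nrm y \<le> b * norm y" using nrm_bounds by metis
  have "bounded_linear (\<lambda>y. T y i)"
    using order_trans[OF T_le_nrm b]
    by (intro bounded_linear_intro[where K = b]) (simp_all add: T_add T_scaleR mult.commute)
  then show ?thesis by (rule linear_continuous_on)
qed

text \<open>The first n coordinates define a norm on the finite-dimensional quotient by their common
  kernel, and it is equivalent to the quotient norm.\<close>

lemma lift_small_coordinates:
  "\<exists>M>0. \<forall>y. \<exists>z. (\<forall>i<n. T z i = 0) \<and> nrm (y - z) \<le> M * (\<Sum>i<n. \<bar>T y i\<bar>)"
proof (induction n)
  case 0
  have "\<exists>z. (\<forall>i<0. T z i = 0) \<and> nrm (y - z) \<le> 1 * (\<Sum>i<0. \<bar>T y i\<bar>)" for y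
    by (rule exI[of _ y]) simp
  then show ?case using zero_less_one by blast
next
  case (Suc n)
  then obtain M where M: "M > 0"
    "\<And>y. \<exists>z. (\<forall>i<n. T z i = 0) \<and> nrm (y - z) \<le> M * (\<Sum>i<n. \<bar>T y i\<bar>)" by blast
  show ?case
  proof (cases "\<exists>e. (\<forall>i<n. T e i = 0) \<and> T e n \<noteq> 0")
    case False
    have "\<exists>z. (\<forall>i<Suc n. T z i = 0) \<and> nrm (y - z) \<le> M * (\<Sum>i<Suc n. \<bar>T y i\<bar>)" for y
    proof -
      obtain z where z: "\<forall>i<n. T z i = 0" "nrm (y - z) \<le> M * (\<Sum>i<n. \<bar>T y i\<bar>)" using M by blast
      have "M * (\<Sum>i<n. \<bar>T y i\<bar>) \<le> M * (\<Sum>i<Suc n. \<bar>T y i\<bar>)" using M by simp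
      then have "nrm (y - z) \<le> M * (\<Sum>i<Suc n. \<bar>T y i\<bar>)" using z(2) by linarith
      then show ?thesis using z(1) False by (intro exI[of _ z]) (auto simp: less_Suc_eq)
    qed
    then show ?thesis using M(1) by blast
  next
    case True
    then obtain e where e: "\<forall>i<n. T e i = 0" "T e n \<noteq> 0" by blast
    \<comment> \<open>\<open>L\<close> is the price of correcting one unit of coordinate n by a
      multiple of \<open>e\<close>; the amount to correct is at most t + M s.\<close>
    define L where "L = nrm e / \<bar>T e n\<bar>"
    have L: "L \<ge> 0" by (simp add: L_def)
    define M' where "M' = M + L * (1 + M)"
    have "M' > 0" using M L by (simp add: M'_def add_pos_nonneg)
    moreover have "\<exists>z. (\<forall>i<Suc n. T z i = 0) \<and> nrm (y - z) \<le> M' * (\<Sum>i<Suc n. \<bar>T y i\<bar>)" for y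
    proof -
      obtain z where z: "\<forall>i<n. T z i = 0" "nrm (y - z) \<le> M * (\<Sum>i<n. \<bar>T y i\<bar>)" using M by blast
      define s where "s = (\<Sum>i<n. \<bar>T y i\<bar>)"
      define t where "t = \<bar>T y n\<bar>"
      define z' where "z' = z - (T z n / T e n) *\<^sub>R e"
      have "s \<ge> 0" by (simp add: s_def sum_nonneg)
      have "t \<ge> 0" by (simp add: t_def)
      have "\<forall>i<Suc n. T z' i = 0" using z(1) e by (simp add: z'_def T_diff T_scaleR less_Suc_eq)
      moreover have "nrm (y - z') \<le> M' * (s + t)"
      proof -
        have "nrm (y - z') = nrm ((y - z) + (T z n / T e n) *\<^sub>R e)" by (simp add: z'_def algebra_simps)
        also have "\<dots> \<le> nrm (y - z) + \<bar>T z n / T e n\<bar> * nrm e"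
          by (intro order_trans[OF nrm_triangle] add_left_mono nrm_scaleR_le)
        also have "\<bar>T z n / T e n\<bar> * nrm e = L * \<bar>T z n\<bar>" by (simp add: L_def abs_divide)
        also have "\<bar>T z n\<bar> \<le> t + M * s"
          using T_le_nrm[of "y - z" n] z(2) by (simp add: T_diff t_def s_def)
        finally have "nrm (y - z') \<le> M * s + L * (t + M * s)"
          using z(2) L by (simp add: s_def mult_left_mono)
        also have "\<dots> \<le> M' * (s + t)"
          using M L \<open>s \<ge> 0\<close> \<open>t \<ge> 0\<close> by (simp add: M'_def algebra_simps)
        finally show ?thesis .
      qed
      ultimately show ?thesis by (auto simp: s_def t_def)
    qed
    ultimately show ?thesis by blast
  qed
qed

text \<open>Rounding the coordinates at scale \<open>e\<close> cuts the ball into finitely many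
  cells. The net takes one element of the ball per cell, because a grid point need not lie in the
  range of \<open>T\<close>.\<close>

lemma coordinate_net:
  assumes e: "e > 0"
  shows "\<exists>F. finite F \<and> F \<subseteq> {y. nrm y \<le> d} \<and>
    (\<forall>y. nrm y \<le> d \<longrightarrow> (\<exists>z\<in>F. \<forall>i<n. \<bar>T y i - T z i\<bar> < e))"
proof -
  define code where "code = (\<lambda>y. restrict (\<lambda>i. \<lfloor>T y i / e\<rfloor>) {..<n})"
  have "code ` {y. nrm y \<le> d} \<subseteq> PiE {..<n} (\<lambda>_. {\<lfloor>- d / e\<rfloor>..\<lfloor>d / e\<rfloor>})"
  proof (clarsimp simp: code_def)
    fix y i assume "nrm y \<le> d"
    then have "- d \<le> T y i" "T y i \<le> d" using T_le_nrm[of y i] by auto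
    then show "\<lfloor>- (d / e)\<rfloor> \<le> \<lfloor>T y i / e\<rfloor> \<and> \<lfloor>T y i / e\<rfloor> \<le> \<lfloor>d / e\<rfloor>"
      using e by (auto intro!: floor_mono simp: field_simps)
  qed
  moreover have "finite (PiE {..<n} (\<lambda>_. {\<lfloor>- d / e\<rfloor>..\<lfloor>d / e\<rfloor>}))" by (intro finite_PiE) auto
  ultimately have "finite (code ` {y. nrm y \<le> d})" by (rule finite_subset)
  from finite_subset_image[OF this order_refl]
  obtain F where F: "finite F" "F \<subseteq> {y. nrm y \<le> d}" "code ` {y. nrm y \<le> d} = code ` F"
    by (elim exE conjE)
  have "\<exists>z\<in>F. \<forall>i<n. \<bar>T y i - T z i\<bar> < e" if "nrm y \<le> d" for y
  proof -
    have "code y \<in> code ` F" unfolding F(3)[symmetric] using that by simp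
    then obtain z where z: "z \<in> F" "code y = code z" by blast
    have "\<bar>T y i - T z i\<bar> < e" if "i < n" for i
    proof -
      have "\<lfloor>T y i / e\<rfloor> = \<lfloor>T z i / e\<rfloor>"
        using fun_cong[OF z(2), of i] that by (simp add: code_def)
      then have "\<bar>T y i / e - T z i / e\<bar> < 1" by linarith
      then show ?thesis using e by (simp add: field_simps abs_less_iff)
    qed
    then show ?thesis using z by blast
  qed
  then show ?thesis using F by blast
qed

text \<open>The Schauder projection of \<open>a \<mapsto> a - \<phi> a\<close>, formed with a finite net for the first \<open>n\<close>
  coordinates, acts on barycentric coordinates; a fixed point of it makes the first \<open>n\<close> coordinates
  of \<open>\<phi> a\<close> small.\<close>

lemma finite_codim_hit:
  assumes d: "d > 0" and e: "e > 0"
  obtains A where "compact A" "\<And>a. a \<in> A \<Longrightarrow> nrm a \<le> d"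
    "\<And>\<phi>. continuous_on A \<phi> \<Longrightarrow> (\<And>a. a \<in> A \<Longrightarrow> nrm (\<phi> a - a) \<le> d) \<Longrightarrow>
      \<exists>a\<in>A. \<exists>z. (\<forall>i<n. T z i = 0) \<and> nrm (\<phi> a - z) \<le> e"
proof -
  obtain M where M: "M > 0"
    "\<And>y. \<exists>z. (\<forall>i<n. T z i = 0) \<and> nrm (y - z) \<le> M * (\<Sum>i<n. \<bar>T y i\<bar>)"
    using lift_small_coordinates by blast
  define e' where "e' = e / M"
  have e': "e' > 0" using e M by (simp add: e'_def)
  obtain F where F: "finite F" "\<And>y. y \<in> F \<Longrightarrow> nrm y \<le> d"
    and net0: "\<And>y. nrm y \<le> d \<Longrightarrow> \<exists>z\<in>F. \<forall>i<n. \<bar>T y i - T z i\<bar> < e' / Suc n"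
    using coordinate_net[of "e' / Suc n" d n] e' by auto
  define s where "s = (\<lambda>y. \<Sum>i<n. \<bar>T y i\<bar>)"
  have net: "\<exists>z\<in>F. s (y - z) < e'" if "nrm y \<le> d" for y
  proof -
    obtain z where z: "z \<in> F" "\<forall>i<n. \<bar>T y i - T z i\<bar> < e' / Suc n" using net0[OF \<open>nrm y \<le> d\<close>] by blast
    have "s (y - z) \<le> (\<Sum>i<n. e' / Suc n)"
      unfolding s_def using z(2) by (intro sum_mono) (auto simp: T_diff intro: less_imp_le)
    also have "\<dots> < e'" using e' by (simp add: field_simps)
    finally show ?thesis using z by blast
  qed
  obtain k and y :: "nat \<Rightarrow> 'b" where y: "F = y ` {..<k}"
    using finite_imp_nat_seg_image_inj_on[OF F(1)] by (auto simp: lessThan_def)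
  \<comment> \<open>0 is included so that coefficients with sum below 1 still give points of
    \<open>A\<close>. The set is chosen before \<open>\<phi>\<close>.\<close>
  define A where "A = convex hull (insert 0 F)"
  have "compact A" unfolding A_def using F by (intro finite_imp_compact_convex_hull) simp
  moreover have "nrm a \<le> d" if "a \<in> A" for a
  proof -
    have "convex {y. nrm y \<le> d}"
    proof (rule convexI, clarify)
      fix x y and u v :: real assume uv: "nrm x \<le> d" "nrm y \<le> d" "0 \<le> u" "0 \<le> v" "u + v = 1"
      have "nrm (u *\<^sub>R x + v *\<^sub>R y) \<le> nrm (u *\<^sub>R x) + nrm (v *\<^sub>R y)" by (rule nrm_triangle)
      also have "\<dots> \<le> u * nrm x + v * nrm y"
        using nrm_scaleR_le[of u x] nrm_scaleR_le[of v y] uv by simp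
      also have "\<dots> \<le> u * d + v * d" using uv by (intro add_mono mult_left_mono)
      also have "\<dots> = d" using uv by (simp flip: distrib_right)
      finally show "nrm (u *\<^sub>R x + v *\<^sub>R y) \<le> d" .
    qed
    then have "A \<subseteq> {y. nrm y \<le> d}" unfolding A_def using F d by (intro hull_minimal) auto
    then show ?thesis using that by blast
  qed
  moreover have "\<exists>a\<in>A. \<exists>z. (\<forall>i<n. T z i = 0) \<and> nrm (\<phi> a - z) \<le> e"
    if cont: "continuous_on A \<phi>" and near: "\<And>a. a \<in> A \<Longrightarrow> nrm (\<phi> a - a) \<le> d" for \<phi>
  proof -
    \<comment> \<open>Dividing by the maximum with 1 makes this continuous on the whole cube; at a
      fixed point of \<open>G\<close> the coefficients sum to 1.\<close>
    define pt where "pt = (\<lambda>l::nat\<Rightarrow>real. \<Sum>j<k. (l j / max 1 (\<Sum>j<k. l j)) *\<^sub>R y j)"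
    \<comment> \<open>Positive exactly for net points close to \<open>a - \<phi> a\<close> in the
      seminorm \<open>s\<close>, where \<open>a = pt l\<close>; as this difference has size at most
      \<open>d\<close>, there is such a point.\<close>
    define w where "w = (\<lambda>l j. max 0 (e' - s (pt l - \<phi> (pt l) - y j)))"
    define G where "G = (\<lambda>l j. if j < k then w l j / (\<Sum>j<k. w l j) else 0)"
    have pt: "pt l \<in> A" if "l \<in> hilbert_cube" for l
    proof -
      have l: "0 \<le> l j" for j using that by (simp add: hilbert_cube_def)
      define c where "c = max 1 (\<Sum>j<k. l j)"
      have c: "c > 0" "(\<Sum>j<k. l j) \<le> c" by (auto simp: c_def)
      have A: "convex A" "0 \<in> A" by (auto simp: A_def convex_convex_hull hull_inc)
      have "(\<Sum>j<k. (l j / c) *\<^sub>R y j) + (1 - (\<Sum>j<k. l j / c)) *\<^sub>R 0 \<in> A"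
      proof -
        have "(\<Sum>j\<in>insert k {..<k}. (if j < k then l j / c else 1 - (\<Sum>j<k. l j / c)) *\<^sub>R
            (if j < k then y j else 0)) \<in> A"
        proof (rule convex_sum)
          show "(\<Sum>j\<in>insert k {..<k}. if j < k then l j / c else 1 - (\<Sum>j<k. l j / c)) = 1"
            by simp
          show "0 \<le> (if j < k then l j / c else 1 - (\<Sum>j<k. l j / c))" for j
            using l c by (simp flip: sum_divide_distrib)
          show "(if j < k then y j else 0) \<in> A" for j using A y by (auto simp: A_def intro: hull_inc)
        qed (use A in auto)
        then show ?thesis by simp
      qed
      then show ?thesis by (simp add: pt_def c_def)
    qed
    have s_cont: "continuous_on UNIV s"
      unfolding s_def by (intro continuous_intros continuous_on_T)
    have coord: "continuous_on S (\<lambda>l::nat\<Rightarrow>real. l j)" for S j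
      by (rule continuous_on_subset[OF continuous_on_product_coordinates subset_UNIV])
    have pt_cont: "continuous_on hilbert_cube pt"
      unfolding pt_def
      by (intro continuous_on_sum continuous_on_scaleR continuous_on_divide continuous_on_max
          continuous_on_const coord) (simp add: max_def)
    have \<phi>pt_cont: "continuous_on hilbert_cube (\<lambda>l. \<phi> (pt l))"
      by (rule continuous_on_compose2[OF cont pt_cont]) (use pt in blast)
    have w_cont: "continuous_on hilbert_cube (\<lambda>l. w l j)" for j
      unfolding w_def
      by (intro continuous_intros pt_cont \<phi>pt_cont continuous_on_compose2[OF s_cont]) auto
    have w_nonneg: "0 \<le> w l j" for l j by (simp add: w_def)
    have w_pos: "(\<Sum>j<k. w l j) > 0" if "l \<in> hilbert_cube" for l
    proof -
      have "nrm (pt l - \<phi> (pt l)) \<le> d" using near[OF pt[OF that]] nrm_minus_commute by metis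
      from net[OF this] obtain j where "j < k" "w l j > 0" using y by (auto simp: w_def)
      then show ?thesis using w_nonneg by (intro sum_pos2[of _ j]) auto
    qed
    have G_le: "G l j \<in> {0..1}" if "l \<in> hilbert_cube" for l j
    proof -
      have "w l j \<le> (\<Sum>j<k. w l j)" if "j < k" using that w_nonneg by (intro member_le_sum) auto
      then show ?thesis using w_pos[OF that] w_nonneg[of l j] by (auto simp: G_def)
    qed
    have "continuous_on hilbert_cube (\<lambda>l. G l j)" for j
    proof (cases "j < k")
      case True
      have "continuous_on hilbert_cube (\<lambda>l. w l j / (\<Sum>j<k. w l j))"
      proof (rule continuous_on_divide[OF w_cont])
        show "continuous_on hilbert_cube (\<lambda>l. \<Sum>j<k. w l j)" by (intro continuous_on_sum w_cont)
        show "\<forall>l\<in>hilbert_cube. (\<Sum>j<k. w l j) \<noteq> 0" using w_pos by (metis less_irrefl)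
      qed
      then show ?thesis using True by (simp add: G_def)
    qed (simp add: G_def)
    then have "continuous_on hilbert_cube G" by (rule continuous_on_coordinatewise_then_product)
    moreover have "G \<in> hilbert_cube \<rightarrow> hilbert_cube" using G_le by (auto simp: hilbert_cube_def)
    ultimately obtain l where l: "l \<in> hilbert_cube" "G l = l" by (rule hilbert_cube_fixpoint)
    define a where "a = pt l"
    have lj: "l j = w l j / (\<Sum>j<k. w l j)" if "j < k" for j using fun_cong[OF l(2), of j] that by (simp add: G_def)
    then have "(\<Sum>j<k. l j) = (\<Sum>j<k. w l j / (\<Sum>j<k. w l j))" by (intro sum.cong) auto
    also have "\<dots> = 1" using w_pos[OF l(1)] by (simp flip: sum_divide_distrib)
    finally have sum1: "(\<Sum>j<k. l j) = 1" .
    then have a: "a = (\<Sum>j<k. l j *\<^sub>R y j)" by (simp add: a_def pt_def)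
    have l_nonneg: "0 \<le> l j" for j using l(1) by (simp add: hilbert_cube_def)
    \<comment> \<open>Since \<open>a\<close> is the barycentre of the \<open>y j\<close>,
      \<open>\<phi> a\<close> is the mean of the vectors \<open>y j - (a - \<phi> a)\<close>, and
      only those with \<open>s\<close> below \<open>e'\<close> carry weight.\<close>
    have T\<phi>: "T (\<phi> a) i = (\<Sum>j<k. l j * - T (a - \<phi> a - y j) i)" for i
    proof -
      have "(\<Sum>j<k. l j * - T (a - \<phi> a - y j) i) = (\<Sum>j<k. l j * T (y j) i) - (\<Sum>j<k. l j) * T (a - \<phi> a) i"
        by (simp add: T_diff T_add algebra_simps sum.distrib sum_subtractf sum_distrib_left sum_distrib_right)
      also have "(\<Sum>j<k. l j * T (y j) i) = T a i" by (simp add: a T_sum T_scaleR)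
      finally show ?thesis by (simp add: sum1 T_diff)
    qed
    have "\<bar>T (\<phi> a) i\<bar> \<le> (\<Sum>j<k. l j * \<bar>T (a - \<phi> a - y j) i\<bar>)" for i
    proof -
      have "\<bar>T (\<phi> a) i\<bar> \<le> (\<Sum>j<k. \<bar>l j * - T (a - \<phi> a - y j) i\<bar>)" unfolding T\<phi> by (rule sum_abs)
      then show ?thesis using l_nonneg by (simp add: abs_mult)
    qed
    then have "s (\<phi> a) \<le> (\<Sum>i<n. \<Sum>j<k. l j * \<bar>T (a - \<phi> a - y j) i\<bar>)"
      unfolding s_def by (intro sum_mono)
    also have "\<dots> = (\<Sum>j<k. l j * s (a - \<phi> a - y j))"
      unfolding s_def by (subst sum.swap) (simp add: sum_distrib_left)
    also have "\<dots> \<le> (\<Sum>j<k. l j * e')"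
    proof (rule sum_mono)
      fix j assume "j \<in> {..<k}"
      then have "w l j > 0" if "l j \<noteq> 0" using that lj[of j] w_nonneg[of l j] by (auto simp: less_le)
      then show "l j * s (a - \<phi> a - y j) \<le> l j * e'"
        using l_nonneg[of j] by (cases "l j = 0") (auto simp: w_def a_def intro!: mult_left_mono)
    qed
    also have "\<dots> = e'" using sum1 by (simp flip: sum_distrib_right)
    finally have "M * s (\<phi> a) \<le> e" using M by (simp add: e'_def field_simps)
    moreover obtain z where "\<forall>i<n. T z i = 0" "nrm (\<phi> a - z) \<le> M * s (\<phi> a)"
      using M unfolding s_def by blast
    ultimately show ?thesis using pt[OF l(1)] unfolding a_def by (meson order_trans)
  qed
  ultimately show thesis by (rule that)
qed

text \<open>Finite codes suffice because \<open>T y\<close> is a null sequence. One element is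
  chosen per code, as rational sequences need not lie in the range of \<open>T\<close>; a code
  without elements contributes an arbitrary point, which does no harm.\<close>

lemma countable_dense:
  obtains D :: "'b set" where "countable D" "\<And>y e. e > 0 \<Longrightarrow> \<exists>z\<in>D. nrm (y - z) < e"
proof -
  define R where "R = (\<lambda>(k::nat) (c::int list) y. (\<forall>i<length c. \<lfloor>k * T y i\<rfloor> = c ! i) \<and>
    (\<forall>i\<ge>length c. \<lfloor>k * T y i\<rfloor> \<in> {-1, 0}))"
  define D where "D = (\<lambda>(k, c). SOME y. R k c y) ` UNIV"
  have "countable D" unfolding D_def by simp
  moreover have "\<exists>z\<in>D. nrm (y - z) < e" if e: "e > 0" for y e
  proof -
    obtain k :: nat where k: "2 / e < k" using reals_Archimedean2 by blast
    then have k0: "real k > 0" using e by (meson divide_pos_pos less_trans zero_less_numeral)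
    obtain n where n: "\<And>i. i \<ge> n \<Longrightarrow> \<bar>T y i\<bar> < 1 / k"
      using LIMSEQ_D[OF T_tendsto[of y], of "1 / k"] k0 by auto
    define c where "c = map (\<lambda>i. \<lfloor>k * T y i\<rfloor>) [0..<n]"
    have "\<lfloor>k * T y i\<rfloor> \<in> {-1, 0}" if "i \<ge> n" for i
    proof -
      have "\<bar>k * T y i\<bar> < 1" using n[OF that] k0 by (simp add: abs_mult field_simps)
      then have "\<lfloor>k * T y i\<rfloor> = -1 \<or> \<lfloor>k * T y i\<rfloor> = 0" by linarith
      then show ?thesis by simp
    qed
    then have Ry: "R k c y" by (auto simp: R_def c_def)
    define z where "z = (SOME y. R k c y)"
    have Rz: "R k c z" unfolding z_def using Ry by (rule someI)
    have "\<bar>k * T y i - k * T z i\<bar> \<le> 2" for i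
    proof (cases "i < length c")
      case True
      then have "\<lfloor>k * T y i\<rfloor> = \<lfloor>k * T z i\<rfloor>" using Ry Rz by (simp add: R_def)
      then show ?thesis by linarith
    next
      case False
      then have "\<lfloor>k * T y i\<rfloor> \<in> {-1, 0}" "\<lfloor>k * T z i\<rfloor> \<in> {-1, 0}" using Ry Rz by (auto simp: R_def)
      then have "\<lfloor>k * T y i\<rfloor> = -1 \<or> \<lfloor>k * T y i\<rfloor> = 0" "\<lfloor>k * T z i\<rfloor> = -1 \<or> \<lfloor>k * T z i\<rfloor> = 0"
        by simp_all
      then show ?thesis by linarith
    qed
    then have "\<bar>T (y - z) i\<bar> \<le> 2 / k" for i
      using k0 by (simp add: T_diff field_simps abs_le_iff)
    then have "nrm (y - z) \<le> 2 / k" by (rule nrm_le)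
    also have "\<dots> < e" using k k0 e by (simp add: field_simps)
    finally show ?thesis by (auto simp: D_def z_def)
  qed
  ultimately show thesis by (rule that)
qed

end

subsection \<open>The Lipschitz norm on the dual\<close>

locale lipschitz_to_c0_subspace = c0_subspace T
  for T :: "'b::real_normed_vector \<Rightarrow> nat \<Rightarrow> real" +
  fixes U :: "'b \<Rightarrow> 'a::real_normed_vector" and V :: "'a \<Rightarrow> 'b" and K :: real
  assumes UV [simp]: "U (V x) = x" and VU [simp]: "V (U y) = y"
    and K: "1 \<le> K"
    and U_lipschitz: "norm (U y - U y') \<le> K * nrm (y - y')"
    and V_lipschitz: "nrm (V x - V x') \<le> K * norm (x - x')"
begin

definition lip_le :: "('a \<Rightarrow> real) \<Rightarrow> real \<Rightarrow> bool" where
  "lip_le f R \<longleftrightarrow> (\<forall>y y'. \<bar>f (U y) - f (U y')\<bar> \<le> R * nrm (y - y'))"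

text \<open>Diagonal pairs contribute 0 by the convention for division. The supremum is meaningful
  only if some bound exists, hence the hypothesis \<open>lip_le f R\<close> with varying
  \<open>R\<close> below.\<close>

definition lip :: "('a \<Rightarrow> real) \<Rightarrow> real" where
  "lip f = (SUP (y, y'). \<bar>f (U y) - f (U y')\<bar> / nrm (y - y'))"

definition dual_ball :: "('a \<Rightarrow> real) set" where
  "dual_ball = {f. linear f \<and> lip_le f 1}"

lemma lip_leD: "lip_le f R \<Longrightarrow> f (U y) - f (U y') \<le> R * nrm (y - y')"
  unfolding lip_le_def by (metis abs_ge_self order_trans)

lemma ratio_le:
  assumes "lip_le f R"
  shows "\<bar>f (U y) - f (U y')\<bar> / nrm (y - y') \<le> max 0 R"
proof (cases "y = y'")
  case False
  then have "nrm (y - y') > 0" by (intro nrm_pos) simp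
  moreover have "\<bar>f (U y) - f (U y')\<bar> \<le> R * nrm (y - y')" using assms by (simp add: lip_le_def)
  ultimately have "\<bar>f (U y) - f (U y')\<bar> / nrm (y - y') \<le> R" by (simp add: field_simps)
  then show ?thesis by simp
qed simp

lemma ratio_le_lip:
  assumes "lip_le f R"
  shows "\<bar>f (U y) - f (U y')\<bar> / nrm (y - y') \<le> lip f"
  unfolding lip_def using ratio_le[OF assms]
  by (intro cSUP_upper2[where x = "(y, y')"]) (auto intro!: bdd_aboveI2)

lemma lip_nonneg: "lip_le f R \<Longrightarrow> 0 \<le> lip f"
  using ratio_le_lip[of f R 0 0] by simp

lemma lip_le_lip:
  assumes "lip_le f R"
  shows "lip_le f (lip f)"
  unfolding lip_le_def
proof (intro allI)
  fix y y'
  show "\<bar>f (U y) - f (U y')\<bar> \<le> lip f * nrm (y - y')"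
  proof (cases "y = y'")
    case False
    then have "nrm (y - y') > 0" by (intro nrm_pos) simp
    then show ?thesis using ratio_le_lip[OF assms, of y y'] by (simp add: field_simps)
  qed simp
qed

lemma lip_least:
  assumes "lip_le f R" "0 \<le> R"
  shows "lip f \<le> R"
  unfolding lip_def using ratio_le[OF assms(1)] assms(2)
  by (intro cSUP_least) auto

lemma lip_approx:
  assumes "lip_le f R" and lin: "linear f" and e: "e > 0" and nontriv: "\<exists>y::'b. y \<noteq> 0"
  obtains y y' where "y \<noteq> y'" "(lip f - e) * nrm (y - y') < f (U y) - f (U y')"
proof -
  have "\<exists>y y'. lip f - e < \<bar>f (U y) - f (U y')\<bar> / nrm (y - y')"
  proof (rule ccontr)
    assume "\<not> ?thesis"
    then have "lip f \<le> lip f - e"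
      unfolding lip_def by (intro cSUP_least) (auto simp: not_less)
    then show False using e by simp
  qed
  then obtain y y' where y: "lip f - e < \<bar>f (U y) - f (U y')\<bar> / nrm (y - y')" by blast
  \<comment> \<open>If the near-optimal pair is diagonal, then \<open>lip f - e\<close> is negative
    and any two distinct points will do.\<close>
  have "\<exists>y y'. y \<noteq> y' \<and> lip f - e < \<bar>f (U y) - f (U y')\<bar> / nrm (y - y')"
  proof (cases "y = y'")
    case True
    obtain z :: 'b where "z \<noteq> 0" using nontriv by blast
    moreover have "lip f - e < 0" using True y by simp
    then have "lip f - e < \<bar>f (U z) - f (U 0)\<bar> / nrm (z - 0)"
      by (rule less_le_trans) simp
    ultimately show ?thesis by blast
  qed (use y in blast)
  then obtain y y' where y: "y \<noteq> y'" "lip f - e < \<bar>f (U y) - f (U y')\<bar> / nrm (y - y')" by blast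
  then have "nrm (y - y') > 0" by (intro nrm_pos) simp
  then have *: "(lip f - e) * nrm (y - y') < \<bar>f (U y) - f (U y')\<bar>" using y by (simp add: field_simps)
  show thesis
  proof (cases "0 \<le> f (U y) - f (U y')")
    case True
    then show ?thesis using * y that by simp
  next
    case False
    then show ?thesis using * y that[of y' y] by (simp add: nrm_minus_commute)
  qed
qed

text \<open>Every x is \<open>U (V x)\<close>; the base point is \<open>V 0\<close>, since
  \<open>U 0\<close> need not be 0.\<close>

lemma functional_bound:
  assumes "lip_le f R" "linear f" "0 \<le> R"
  shows "\<bar>f x\<bar> \<le> R * K * norm x"
proof -
  have "\<bar>f (U (V x)) - f (U (V 0))\<bar> \<le> R * nrm (V x - V 0)" using assms(1) unfolding lip_le_def by blast
  also have "\<dots> \<le> R * (K * norm (x - 0))" using V_lipschitz assms(3) by (intro mult_left_mono)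
  finally show ?thesis using linear_0[OF assms(2)] by (simp add: mult.assoc)
qed

lemma lip_le_diff:
  assumes "lip_le f R" "lip_le g S"
  shows "lip_le (\<lambda>x. f x - g x) (R + S)"
  unfolding lip_le_def
proof (intro allI)
  fix y y'
  have "\<bar>f (U y) - f (U y')\<bar> \<le> R * nrm (y - y')" "\<bar>g (U y) - g (U y')\<bar> \<le> S * nrm (y - y')"
    using assms by (auto simp: lip_le_def)
  then show "\<bar>f (U y) - g (U y) - (f (U y') - g (U y'))\<bar> \<le> (R + S) * nrm (y - y')"
    by (simp add: distrib_right)
qed

text \<open>Asymptotically the norm \<^term>\<open>lip\<close> is additive up to a constant along weak-star small
  perturbations. If the pair \<open>m + h\<close>, \<open>m - h\<close> nearly attains the Lipschitz constant of \<open>p \<circ> U\<close>, then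
  \<open>p\<close> is nearly constant on the images of \<open>m + z\<close> for \<open>z\<close> in a subspace of finite codimension, since
  in \<open>c\<^sub>0\<close> such \<open>z\<close> hardly change \<open>\<parallel>h \<plusminus> z\<parallel>\<close>; by Gorelik's principle these images are rich enough
  to norm \<open>f - p\<close> up to a compact set.\<close>

lemma lip_asymptotically_additive:
  assumes p: "p \<in> dual_ball" and \<eta>: "\<eta> > 0" and nontriv: "\<exists>y::'b. y \<noteq> 0"
  shows "\<exists>F \<delta>. finite F \<and> 0 < \<delta> \<and> (\<forall>f\<in>dual_ball. (\<forall>x\<in>F. \<bar>f x - p x\<bar> < \<delta>) \<longrightarrow>
     lip p + lip (\<lambda>x. f x - p x) / (3 * K\<^sup>2) - \<eta> \<le> lip f)"
proof -
  have plin: "linear p" and plip: "lip_le p 1" using p by (auto simp: dual_ball_def)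
  \<comment> \<open>The final estimate collects nine errors of size at most \<open>e * r\<close>;
    the bound 1/3 gives \<open>\<epsilon> \<le> d\<close>.\<close>
  define e where "e = min (\<eta> / 9) (1 / 3)"
  have e: "e > 0" "9 * e \<le> \<eta>" "e \<le> 1 / 3" using \<eta> by (auto simp: e_def)
  have K0: "K > 0" using K by simp
  have K2: "K\<^sup>2 \<ge> 1" using K by simp
  obtain y y' where yy: "y \<noteq> y'" "(lip p - e) * nrm (y - y') < p (U y) - p (U y')"
    using lip_approx[OF plip plin e(1) nontriv] by blast
  define m where "m = (1/2) *\<^sub>R (y + y')"
  define h where "h = (1/2) *\<^sub>R (y - y')"
  define r where "r = nrm h"
  have y: "y = m + h" and y': "y' = m - h"
    unfolding m_def h_def by (simp_all add: algebra_simps flip: scaleR_add_left)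
  have "h \<noteq> 0" using yy(1) y y' by auto
  then have r: "r > 0" unfolding r_def by (rule nrm_pos)
  have "2 * r \<le> nrm (y - y')"
    unfolding r_def h_def using nrm_scaleR_le[of "1/2" "y - y'"] by simp
  moreover have "nrm (y - y') \<le> 2 * r"
    using nrm_triangle[of h h] by (simp add: y y' r_def)
  ultimately have "nrm (y - y') = 2 * r" by simp
  with yy(2) have ph: "(lip p - e) * (2 * r) < p (U (m + h)) - p (U (m - h))" by (simp add: y y')
  have "e * r > 0" using e r by simp
  from LIMSEQ_D[OF T_tendsto[of h] this]
  obtain n where n: "\<And>i. i \<ge> n \<Longrightarrow> \<bar>T h i\<bar> \<le> e * r" by (auto intro: less_imp_le)
  \<comment> \<open>A third of \<open>r\<close>, so that
    \<open>nrm z \<le> \<epsilon> + 2 * d \<le> r\<close> for the point \<open>z\<close> found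
    below.\<close>
  define d where "d = r / 3"
  define \<epsilon> where "\<epsilon> = e * r / (2 * K\<^sup>2)"
  have d: "d > 0" using r by (simp add: d_def)
  have \<epsilon>: "\<epsilon> > 0" using e r K0 by (simp add: \<epsilon>_def)
  have "\<epsilon> \<le> d"
  proof -
    have "e * r \<le> (1 / 3) * r" using e r by (intro mult_right_mono) auto
    then have "e * r / (2 * K\<^sup>2) \<le> (r / 3) / 1" using K2 r by (intro frac_le) auto
    then show ?thesis by (simp add: \<epsilon>_def d_def)
  qed
  obtain A where A: "compact A" "\<And>a. a \<in> A \<Longrightarrow> nrm a \<le> d"
    "\<And>\<phi>. continuous_on A \<phi> \<Longrightarrow> (\<And>a. a \<in> A \<Longrightarrow> nrm (\<phi> a - a) \<le> d) \<Longrightarrow>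
      \<exists>a\<in>A. \<exists>z. (\<forall>i<n. T z i = 0) \<and> nrm (\<phi> a - z) \<le> \<epsilon>"
    using finite_codim_hit[OF d \<epsilon>] by blast
  define M where "M = (1/2) *\<^sub>R (U (m + h) + U (m - h))"
  have contU: "continuous_on S U" for S
  proof -
    obtain b where b: "0 < b" "\<And>y. nrm y \<le> b * norm y" using nrm_bounds by metis
    have "dist (U x) (U y) \<le> (K * b) * dist x y" for x y
    proof -
      have "K * nrm (x - y) \<le> K * (b * norm (x - y))" using K0 b by (intro mult_left_mono) auto
      then show ?thesis using U_lipschitz[of x y] by (simp add: dist_norm mult.assoc)
    qed
    then have "(K * b)-lipschitz_on S U" using K0 b by (intro lipschitz_onI) auto
    then show ?thesis by (rule lipschitz_on_continuous_on)
  qed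
  have contV: "continuous_on S V" for S
  proof -
    obtain a where a: "0 < a" "\<And>y. a * norm y \<le> nrm y" using nrm_bounds by metis
    have "dist (V x) (V y) \<le> (K / a) * dist x y" for x y
      using a(2)[of "V x - V y"] V_lipschitz[of x y] a(1) by (simp add: dist_norm field_simps)
    then have "(K / a)-lipschitz_on S V" using K0 a by (intro lipschitz_onI) auto
    then show ?thesis by (rule lipschitz_on_continuous_on)
  qed
  define \<epsilon>0 where "\<epsilon>0 = e * r / (2 * K)"
  have \<epsilon>0: "\<epsilon>0 > 0" using e r K0 by (simp add: \<epsilon>0_def)
  have contUm: "continuous_on A (\<lambda>a. U (m + a))"
    by (rule continuous_on_compose2[OF contU[of UNIV]]) (auto intro!: continuous_intros)
  have "compact ((\<lambda>a. U (m + a) - M) ` A)"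
    using A(1) contUm by (intro compact_continuous_image continuous_on_diff continuous_on_const)
  \<comment> \<open>Smallness of \<open>f - p\<close> on this finite net, chosen before
    \<open>f\<close>, makes it small on all of \<open>U (m + a) - M\<close> for \<open>a\<close> in
    \<open>A\<close>.\<close>
  then obtain F where F: "finite F" "(\<lambda>a. U (m + a) - M) ` A \<subseteq> (\<Union>x\<in>F. ball x \<epsilon>0)"
    using \<epsilon>0 unfolding compact_eq_totally_bounded by blast
  have main: "lip p + lip (\<lambda>x. f x - p x) / (3 * K\<^sup>2) - \<eta> \<le> lip f"
    if f: "f \<in> dual_ball" and small: "\<And>x. x \<in> insert (U (m + h) - M) F \<Longrightarrow> \<bar>f x - p x\<bar> < e * r" for f
  proof -
    define v where "v = (\<lambda>x. f x - p x)"
    have flin: "linear f" and flip: "lip_le f 1" using f by (auto simp: dual_ball_def)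
    have vlin: "linear v" unfolding v_def by (intro linear_compose_sub flin plin)
    have vlip: "lip_le v 2" using lip_le_diff[OF flip plip] by (simp add: v_def)
    have vbound: "\<bar>v x\<bar> \<le> 2 * K * norm x" for x using functional_bound[OF vlip vlin] by simp
    obtain w w' where w: "w \<noteq> w'" "(lip v - e) * nrm (w - w') < v (U w) - v (U w')"
      using lip_approx[OF vlip vlin e(1) nontriv] by blast
    define s where "s = nrm (w - w')"
    have s: "s > 0" unfolding s_def using w(1) by (intro nrm_pos) simp
    \<comment> \<open>Scaled so that translation by \<open>x\<close> moves points of Y by at most
      \<open>d\<close>; the sign of \<open>x\<close> makes \<open>v x\<close> about
      \<open>- lip v * r / (3 * K\<^sup>2)\<close>.\<close>
    define t where "t = d / (K\<^sup>2 * s)"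
    have t: "t > 0" using d K0 s by (simp add: t_def)
    define x where "x = (- t) *\<^sub>R (U w - U w')"
    have x_norm: "K * norm x \<le> d"
    proof -
      have "K * norm x = K * t * norm (U w - U w')" using t by (simp add: x_def)
      also have "\<dots> \<le> K * t * (K * s)"
        unfolding s_def using U_lipschitz K0 t by (intro mult_left_mono) auto
      also have "\<dots> = d" using s K0 by (simp add: t_def power2_eq_square)
      finally show ?thesis .
    qed
    have vx: "v x \<le> - (lip v - e) * (r / (3 * K\<^sup>2))"
    proof -
      have "t * ((lip v - e) * s) \<le> t * (v (U w) - v (U w'))" using w(2) t by (simp add: s_def)
      moreover have "v x = - (t * (v (U w) - v (U w')))"
        by (simp add: x_def linear_diff[OF vlin] linear_cmul[OF vlin] algebra_simps)
      moreover have "t * ((lip v - e) * s) = (lip v - e) * (r / (3 * K\<^sup>2))"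
        using s K0 by (simp add: t_def d_def)
      ultimately show ?thesis unfolding mult_minus_left by linarith
    qed
    \<comment> \<open>The translation by \<open>x\<close> in X, carried back to Y and recentred at
      \<open>m\<close>.\<close>
    define \<phi> where "\<phi> = (\<lambda>a. V (x + U (m + a)) - m)"
    have "continuous_on A \<phi>"
      unfolding \<phi>_def
      by (intro continuous_on_diff continuous_on_const continuous_on_compose2[OF contV[of UNIV]]
          continuous_on_add contUm) auto
    moreover have \<phi>_near: "nrm (\<phi> a - a) \<le> d" for a
    proof -
      have "nrm (V (x + U (m + a)) - V (U (m + a))) \<le> K * norm x"
        using V_lipschitz[of "x + U (m + a)" "U (m + a)"] by simp
      moreover have "\<phi> a - a = V (x + U (m + a)) - V (U (m + a))" by (simp add: \<phi>_def)
      ultimately show ?thesis using x_norm by (metis order_trans)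
    qed
    ultimately obtain a z where a: "a \<in> A" and z: "\<And>i. i < n \<Longrightarrow> T z i = 0" and \<phi>z: "nrm (\<phi> a - z) \<le> \<epsilon>"
      using A(3) by blast
    have "nrm z \<le> nrm (z - \<phi> a) + nrm ((\<phi> a - a) + a)" using nrm_triangle[of "z - \<phi> a" "\<phi> a"] by simp
    also have "\<dots> \<le> \<epsilon> + (d + d)"
      using \<phi>z A(2)[OF a] \<phi>_near[of a] nrm_triangle[of "\<phi> a - a" a] nrm_minus_commute[of z "\<phi> a"] by simp
    also have "\<dots> \<le> r" using \<open>\<epsilon> \<le> d\<close> by (simp add: d_def)
    finally have zr: "nrm z \<le> r" .
    have hz: "nrm (h + z) \<le> r + e * r"
      using n z zr e r by (intro nrm_add_tail_le[of n]) (auto simp: r_def)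
    have hz': "nrm (h - z) \<le> r + e * r"
      using n z zr e r nrm_add_tail_le[of n h "e * r" "- z" r] by (auto simp: r_def T_minus nrm_minus)
    define u where "u = U (m + z) - M"
    have vu: "v u \<le> - (lip v - e) * (r / (3 * K\<^sup>2)) + 3 * (e * r)"
    proof -
      define g where "g = U (m + z) - U (m + \<phi> a)"
      have "m + \<phi> a = V (x + U (m + a))" by (simp add: \<phi>_def)
      then have "U (m + \<phi> a) = x + U (m + a)" by simp
      \<comment> \<open>The three parts are the translation, a point covered by the net, and the
        error of hitting the subspace.\<close>
      then have "u = x + (U (m + a) - M) + g" by (simp add: u_def g_def)
      then have eq: "v u = v x + v (U (m + a) - M) + v g" by (simp add: linear_add[OF vlin])
      have "norm g \<le> K * nrm (z - \<phi> a)" using U_lipschitz[of "m + z" "m + \<phi> a"] by (simp add: g_def)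
      also have "\<dots> \<le> K * \<epsilon>" using \<phi>z K0 nrm_minus_commute[of z "\<phi> a"] by (intro mult_left_mono) auto
      finally have "2 * K * norm g \<le> 2 * K * (K * \<epsilon>)" using K0 by (intro mult_left_mono) auto
      also have "\<dots> = e * r" using K0 by (simp add: \<epsilon>_def power2_eq_square)
      finally have vg: "v g \<le> e * r" using vbound[of g] by linarith
      obtain b where b: "b \<in> F" "dist b (U (m + a) - M) < \<epsilon>0" using F(2) a by auto
      have "2 * K * norm (U (m + a) - M - b) \<le> 2 * K * \<epsilon>0"
        using b(2) K0 by (intro mult_left_mono) (auto simp: dist_norm norm_minus_commute)
      also have "\<dots> = e * r" using K0 by (simp add: \<epsilon>0_def)
      finally have "v (U (m + a) - M - b) \<le> e * r" using vbound[of "U (m + a) - M - b"] by linarith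
      moreover have "v b < e * r" using small[of b] b(1) by (auto simp: v_def)
      ultimately have "v (U (m + a) - M) \<le> 2 * (e * r)"
        using linear_diff[OF vlin, of "U (m + a) - M" b] by linarith
      then show ?thesis using eq vx vg by linarith
    qed
    have ph': "2 * (lip p * r) - 2 * (e * r) < p (U (m + h)) - p (U (m - h))"
      using ph by (simp add: algebra_simps)
    have pM: "p M = (p (U (m + h)) + p (U (m - h))) / 2"
      by (simp add: M_def linear_cmul[OF plin] linear_add[OF plin])
    have lip1: "lip p \<le> 1" "lip f \<le> 1" using lip_least plip flip by auto
    \<comment> \<open>\<open>U (m + z)\<close> cannot lie much above \<open>M\<close> in the
      direction of \<open>p\<close>, as \<open>m + z\<close> is within about \<open>r\<close> of the
      lower endpoint \<open>m - h\<close>.\<close>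
    have pu: "p u \<le> 2 * (e * r)"
    proof -
      have "p (U (m + z)) - p (U (m - h)) \<le> lip p * nrm (m + z - (m - h))"
        by (rule lip_leD[OF lip_le_lip[OF plip]])
      also have "\<dots> \<le> lip p * (r + e * r)"
        using hz lip_nonneg[OF plip] by (intro mult_left_mono) (auto simp: add.commute)
      also have "\<dots> \<le> lip p * r + e * r"
        using mult_right_mono[OF lip1(1), of "e * r"] e r by (simp add: distrib_left)
      finally have "p (U (m + z)) - p M \<le> 2 * (e * r)" using ph' pM by argo
      then show ?thesis by (simp add: u_def linear_diff[OF plin])
    qed
    \<comment> \<open>This pair, at distance about \<open>r\<close>, tests \<open>lip f\<close>:
      along it \<open>p\<close> gains about \<open>lip p * r\<close>, and \<open>v\<close> gains
      about \<open>lip v * r / (3 * K\<^sup>2)\<close>.\<close>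
    have "f (U (m + h)) - f (U (m + z)) \<le> lip f * nrm (m + h - (m + z))"
      by (rule lip_leD[OF lip_le_lip[OF flip]])
    also have "\<dots> \<le> lip f * (r + e * r)"
      using hz' lip_nonneg[OF flip] by (intro mult_left_mono) auto
    also have "\<dots> \<le> lip f * r + e * r"
      using mult_right_mono[OF lip1(2), of "e * r"] e r by (simp add: distrib_left)
    finally have up: "f (U (m + h)) - f (U (m + z)) \<le> lip f * r + e * r" .
    have fpv: "f x = p x + v x" for x by (simp add: v_def)
    have "f (U (m + h)) - f (U (m + z)) = f (U (m + h) - M) - f u"
      by (simp add: u_def linear_diff[OF flin])
    also have "\<dots> = p (U (m + h) - M) - p u + v (U (m + h) - M) - v u" by (simp add: fpv)
    finally have dec: "f (U (m + h)) - f (U (m + z)) = p (U (m + h) - M) - p u + v (U (m + h) - M) - v u" .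
    have p1: "p (U (m + h) - M) \<ge> lip p * r - e * r"
      unfolding linear_diff[OF plin] using ph' pM by argo
    have v1: "v (U (m + h) - M) \<ge> - (e * r)" using small[of "U (m + h) - M"] by (auto simp: v_def abs_less_iff)
    have er: "e * (r / (3 * K\<^sup>2)) \<le> e * r"
      using e r K2 by (intro mult_left_mono) (auto simp: divide_le_eq)
    have "lip p * r + lip v * (r / (3 * K\<^sup>2)) - 9 * (e * r) \<le> lip f * r"
    proof -
      have "- (lip v - e) * (r / (3 * K\<^sup>2)) = e * (r / (3 * K\<^sup>2)) - lip v * (r / (3 * K\<^sup>2))"
        by (simp add: left_diff_distrib diff_divide_distrib)
      then show ?thesis using up dec p1 v1 pu vu er by linarith
    qed
    then have "(lip p + lip v / (3 * K\<^sup>2) - 9 * e) * r \<le> lip f * r" by (simp add: algebra_simps)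
    then have "lip p + lip v / (3 * K\<^sup>2) - 9 * e \<le> lip f" using r by simp
    then show ?thesis using e(2) unfolding v_def by linarith
  qed
  then show ?thesis
    using F(1) e r by (intro exI[of _ "insert (U (m + h) - M) F"] exI[of _ "e * r"]) auto
qed

end

subsection \<open>Norming sets that are weak-star null\<close>

text \<open>The disjoint union is enumerated: tagging by j makes it infinite even if functionals
  recur, and only finitely many indices belong to j < J.\<close>

lemma sequence_of_finite_sets:
  fixes D :: "nat \<Rightarrow> ('a \<Rightarrow> real) set"
  assumes fin: "\<And>j. finite (D j)" and ne: "\<And>j. D j \<noteq> {}"
    and null: "\<And>x e. e > 0 \<Longrightarrow> \<exists>J. \<forall>j\<ge>J. \<forall>f\<in>D j. \<bar>f x\<bar> < e"
  obtains g :: "nat \<Rightarrow> 'a \<Rightarrow> real" where "range g = (\<Union>j. D j)" "\<And>x. (\<lambda>n. g n x) \<longlonglongrightarrow> 0"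
proof -
  define S where "S = (SIGMA j:UNIV. D j)"
  have "countable S" unfolding S_def using fin by (intro countable_SIGMA) (auto intro: countable_finite)
  moreover have "infinite S"
  proof
    assume "finite S"
    then have "finite (fst ` S)" by simp
    moreover have "fst ` S = UNIV" using ne by (force simp: S_def)
    ultimately show False by simp
  qed
  ultimately have bij: "bij_betw (from_nat_into S) UNIV S" by (rule bij_betw_from_nat_into)
  define g where "g = (\<lambda>n. snd (from_nat_into S n))"
  have "range g = snd ` S" using bij by (auto simp: g_def bij_betw_def image_image[symmetric])
  also have "\<dots> = (\<Union>j. D j)" by (force simp: S_def)
  finally have "range g = (\<Union>j. D j)" .
  moreover have "(\<lambda>n. g n x) \<longlonglongrightarrow> 0" for x
  proof (rule LIMSEQ_I)
    fix e :: real assume "e > 0"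
    then obtain J where J: "\<And>j f. j \<ge> J \<Longrightarrow> f \<in> D j \<Longrightarrow> \<bar>f x\<bar> < e" using null by blast
    have "finite (SIGMA j:{..<J}. D j)" using fin by (intro finite_SigmaI) auto
    then have "finite (from_nat_into S -` (SIGMA j:{..<J}. D j))"
      using bij by (intro finite_vimageI) (auto simp: bij_betw_def)
    then obtain N where N: "\<And>n. n \<in> from_nat_into S -` (SIGMA j:{..<J}. D j) \<Longrightarrow> n < N"
      by (auto simp: finite_nat_set_iff_bounded)
    have "norm (g n x - 0) < e" if "n \<ge> N" for n
    proof -
      obtain j f where jf: "from_nat_into S n = (j, f)" by fastforce
      moreover have "from_nat_into S n \<in> S" using bij by (auto simp: bij_betw_def)
      ultimately have "f \<in> D j" by (simp add: S_def)
      moreover have "j \<ge> J" using N[of n] that jf \<open>f \<in> D j\<close> by (cases "j < J") auto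
      ultimately show ?thesis using J jf by (simp add: g_def)
    qed
    then show "\<exists>N. \<forall>n\<ge>N. norm (g n x - 0) < e" by blast
  qed
  ultimately show thesis by (rule that)
qed

section \<open>Weak-star compactness and the construction of the norming sequence\<close>

context lipschitz_to_c0_subspace
begin

text \<open>Banach-Alaoglu: the topology on functions is pointwise convergence, linearity and the
  Lipschitz bound are closed conditions, and \<open>functional_bound\<close> confines the ball to a
  product of intervals.\<close>

lemma compact_dual_ball: "compact dual_ball"
proof -
  define C where "C = {f :: 'a \<Rightarrow> real. \<forall>x. f x \<in> {- (K * norm x)..K * norm x}}"
  define L where "L = {f :: 'a \<Rightarrow> real. \<forall>x y c. f (x + y) = f x + f y \<and> f (c *\<^sub>R x) = c * f x}"
  have ev: "continuous_on UNIV (\<lambda>f::'a\<Rightarrow>real. f x)" for x by (rule continuous_on_product_coordinates)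
  have "compact C" unfolding C_def by (rule compact_Pi_UNIV) simp
  moreover have "closed L"
    unfolding L_def
    by (intro closed_Collect_all closed_Collect_conj closed_Collect_eq
        continuous_on_add continuous_on_mult continuous_on_const ev)
  moreover have "closed {f. lip_le f 1}"
    unfolding lip_le_def
    by (intro closed_Collect_all closed_Collect_le continuous_on_rabs
        continuous_on_diff continuous_on_const ev)
  ultimately have "compact (C \<inter> (L \<inter> {f. lip_le f 1}))" by (intro compact_Int_closed closed_Int)
  also have "C \<inter> (L \<inter> {f. lip_le f 1}) = dual_ball"
  proof -
    have "linear f \<longleftrightarrow> f \<in> L" for f :: "'a \<Rightarrow> real" by (auto simp: linear_iff L_def)
    moreover have "f \<in> C" if "linear f" "lip_le f 1" for f
      using functional_bound[OF that(2,1)] by (simp add: C_def abs_le_iff minus_le_iff)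
    ultimately show ?thesis by (auto simp: dual_ball_def)
  qed
  finally show ?thesis .
qed

text \<open>\<open>lip_asymptotically_additive\<close> holds on a weak-star neighbourhood of each
  \<open>p\<close>; compactness leaves finitely many centres.\<close>

lemma finite_cover_dual_ball:
  assumes A: "finite A" and e: "e > 0" and \<eta>: "\<eta> > 0" and nontriv: "\<exists>y::'b. y \<noteq> 0"
  obtains S where "finite S" "S \<subseteq> dual_ball"
    "\<And>f. f \<in> dual_ball \<Longrightarrow> \<exists>p\<in>S. (\<forall>x\<in>A. \<bar>f x - p x\<bar> < e) \<and>
      lip p + lip (\<lambda>x. f x - p x) / (3 * K\<^sup>2) - \<eta> \<le> lip f"
proof -
  define good where "good = (\<lambda>f p. (\<forall>x\<in>A. \<bar>f x - p x\<bar> < e) \<and>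
    lip p + lip (\<lambda>x. f x - p x) / (3 * K\<^sup>2) - \<eta> \<le> lip f)"
  have "\<exists>W. open W \<and> p \<in> W \<and> (\<forall>f\<in>dual_ball \<inter> W. good f p)" if p: "p \<in> dual_ball" for p
  proof -
    obtain F \<delta> where F: "finite F" "0 < \<delta>"
      and add: "\<And>f. f \<in> dual_ball \<Longrightarrow> (\<forall>x\<in>F. \<bar>f x - p x\<bar> < \<delta>) \<Longrightarrow>
        lip p + lip (\<lambda>x. f x - p x) / (3 * K\<^sup>2) - \<eta> \<le> lip f"
      using lip_asymptotically_additive[OF p \<eta> nontriv] by blast
    define W where "W = {f. \<forall>x\<in>A \<union> F. f (id x) \<in> ball (p x) (min e \<delta>)}"
    have W: "f \<in> W \<longleftrightarrow> (\<forall>x\<in>A \<union> F. \<bar>f x - p x\<bar> < min e \<delta>)" for f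
      by (auto simp: W_def dist_real_def abs_minus_commute)
    have "open W" unfolding W_def using A F(1) by (intro product_topology_basis') auto
    moreover have "p \<in> W" using e F(2) by (simp add: W)
    moreover have "\<forall>f\<in>dual_ball \<inter> W. good f p" using add by (simp add: W good_def)
    ultimately show ?thesis by blast
  qed
  then have "\<exists>W. \<forall>p\<in>dual_ball. open (W p) \<and> p \<in> W p \<and> (\<forall>f\<in>dual_ball \<inter> W p. good f p)"
    by (intro bchoice) blast
  then obtain W where W: "\<And>p. p \<in> dual_ball \<Longrightarrow> open (W p)" "\<And>p. p \<in> dual_ball \<Longrightarrow> p \<in> W p"
    "\<And>p f. p \<in> dual_ball \<Longrightarrow> f \<in> dual_ball \<Longrightarrow> f \<in> W p \<Longrightarrow> good f p"
    by blast
  obtain S where S: "S \<subseteq> dual_ball" "finite S" "dual_ball \<subseteq> (\<Union>p\<in>S. W p)"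
    by (rule compactE_image[OF compact_dual_ball, of dual_ball W]) (use W(1,2) in auto)
  have "\<exists>p\<in>S. good f p" if "f \<in> dual_ball" for f
    using that S W(3) by blast
  then show thesis using that[OF S(2,1)] unfolding good_def by blast
qed

text \<open>A functional is approximated by \<open>p\<^sub>J \<in> S J\<close>, then \<open>p\<^sub>J\<close> by \<open>p\<^sub>J\<^sub>-\<^sub>1 \<in> S (J - 1)\<close>, and so on. Going
  backwards keeps the constant \<open>3 * K\<^sup>2\<close> from being compounded, so that the increments
  \<open>p\<^sub>j\<^sub>+\<^sub>1 - p\<^sub>j\<close> have summable norms; as they are weak-star small, their normalisations form a
  weak-star null sequence which is norming.\<close>

lemma weak_star_null_norming_sets:
  assumes nontriv: "\<exists>y::'b. y \<noteq> 0"
  obtains D :: "nat \<Rightarrow> ('a \<Rightarrow> real) set" and C :: real where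
    "\<And>j. finite (D j)" "\<And>j. D j \<noteq> {}" "\<And>j f. f \<in> D j \<Longrightarrow> linear f"
    "\<And>j f x. f \<in> D j \<Longrightarrow> \<bar>f x\<bar> \<le> K * norm x"
    "\<And>x e. e > 0 \<Longrightarrow> \<exists>J. \<forall>j\<ge>J. \<forall>f\<in>D j. \<bar>f x\<bar> < e"
    "C > 0" "\<And>x R. \<forall>j. \<forall>f\<in>D j. \<bar>f x\<bar> \<le> R \<Longrightarrow> norm x \<le> C * R"
proof -
  have K0: "K > 0" using K by simp
  have K2: "K\<^sup>2 \<ge> 1" using K by simp
  define c where "c = 3 * K\<^sup>2"
  have c: "c \<ge> 1" using K2 by (simp add: c_def)
  obtain Y :: "'b set" where Y: "countable Y" "\<And>y e. e > 0 \<Longrightarrow> \<exists>z\<in>Y. nrm (y - z) < e"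
    using countable_dense by blast
  define g where "g = (\<lambda>i. U (from_nat_into Y i))"
  have "Y \<noteq> {}" using Y(2)[of 1 0] by auto
  have dense: "\<exists>i. norm (x - g i) < e" if "e > 0" for x e
  proof -
    have "e / K > 0" using that K0 by simp
    then obtain z where z: "z \<in> Y" "nrm (V x - z) < e / K" using Y(2) by blast
    then obtain i where i: "z = from_nat_into Y i" using from_nat_into_surj[OF Y(1)] by metis
    have "norm (U (V x) - U z) \<le> K * nrm (V x - z)" by (rule U_lipschitz)
    also have "\<dots> < e" using z(2) K0 by (simp add: field_simps)
    finally show ?thesis using i by (auto simp: g_def)
  qed
  have zero: "(\<lambda>x. 0) \<in> dual_ball" by (simp add: dual_ball_def lip_le_def linear_iff)
  have lip_zero: "lip (\<lambda>x. 0) = 0" by (simp add: lip_def case_prod_unfold)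
  define good where "good = (\<lambda>j f p. (\<forall>i<j. \<bar>f (g i) - p (g i)\<bar> < (1/4)^j) \<and>
      lip p + lip (\<lambda>x. f x - p x) / c - (1/2)^j \<le> lip f)"
  have "\<forall>j. \<exists>S. finite S \<and> S \<subseteq> dual_ball \<and> (\<forall>f\<in>dual_ball. \<exists>p\<in>S. good j f p) \<and>
      (j = 0 \<longrightarrow> S = {\<lambda>x. 0})"
  proof
    fix j
    show "\<exists>S. finite S \<and> S \<subseteq> dual_ball \<and> (\<forall>f\<in>dual_ball. \<exists>p\<in>S. good j f p) \<and>
      (j = 0 \<longrightarrow> S = {\<lambda>x. 0})"
    proof (cases "j = 0")
      \<comment> \<open>At level 0 no points are tested and c is at least 1, so the zero functional
        approximates everything and every chain can end there.\<close>
      case True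
      have lip_c: "lip f / c \<le> lip f" if "f \<in> dual_ball" for f
        using c that lip_nonneg[of f 1] mult_left_mono[of 1 c "lip f"] by (simp add: divide_le_eq dual_ball_def)
      have "good 0 f (\<lambda>x. 0)" if "f \<in> dual_ball" for f
        using lip_c[OF that] lip_zero by (simp add: good_def)
      then show ?thesis using True zero by (intro exI[of _ "{\<lambda>x. 0}"]) auto
    next
      case False
      obtain S where S: "finite S" "S \<subseteq> dual_ball"
        "\<And>f. f \<in> dual_ball \<Longrightarrow> \<exists>p\<in>S. (\<forall>x\<in>g ` {..<j}. \<bar>f x - p x\<bar> < (1/4)^j) \<and>
          lip p + lip (\<lambda>x. f x - p x) / (3 * K\<^sup>2) - (1/2)^j \<le> lip f"
        by (rule finite_cover_dual_ball[of "g ` {..<j}" "(1/4)^j" "(1/2)^j"]) (use nontriv in auto)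
      have "\<exists>p\<in>S. good j f p" if "f \<in> dual_ball" for f
      proof -
        from S(3)[OF that] obtain p where "p \<in> S" "\<forall>x\<in>g ` {..<j}. \<bar>f x - p x\<bar> < (1/4)^j"
          "lip p + lip (\<lambda>x. f x - p x) / (3 * K\<^sup>2) - (1/2)^j \<le> lip f" by blast
        then have "good j f p" by (simp add: good_def c_def)
        then show ?thesis using \<open>p \<in> S\<close> by blast
      qed
      then have "finite S \<and> S \<subseteq> dual_ball \<and> (\<forall>f\<in>dual_ball. \<exists>p\<in>S. good j f p)" using S(1,2) by blast
      then show ?thesis using False by blast
    qed
  qed
  from choice[OF this]
  obtain S where S_all: "\<forall>j. finite (S j) \<and> S j \<subseteq> dual_ball \<and>
    (\<forall>f\<in>dual_ball. \<exists>p\<in>S j. good j f p) \<and> (j = 0 \<longrightarrow> S j = {\<lambda>x. 0})" by (elim exE)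
  have S: "finite (S j)" "S j \<subseteq> dual_ball" "S 0 = {\<lambda>x. 0}" for j
    using S_all by simp_all
  have cover: "\<exists>p\<in>S j. (\<forall>i<j. \<bar>f (g i) - p (g i)\<bar> < (1/4)^j) \<and>
      lip p + lip (\<lambda>x. f x - p x) / c - (1/2)^j \<le> lip f" if "f \<in> dual_ball" for j f
    using S_all that by (simp add: good_def)
  \<comment> \<open>The summand keeps the denominator at least (1/2)^j, so increments below (1/4)^j
    at the tested points stay below (1/2)^j after division; over all j it adds at most 2.\<close>
  define N where "N = (\<lambda>(j::nat) q p. lip (\<lambda>x::'a. q x - p x) + (1/2)^j)"
  define quot where "quot = (\<lambda>j (q, p). \<lambda>x::'a. (q x - p x) / N j q p)"
  \<comment> \<open>The zero functional makes each set nonempty and later yields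
    \<open>R \<ge> 0\<close>.\<close>
  define D where "D = (\<lambda>j. insert (\<lambda>x. 0) (quot j ` {(q, p). q \<in> S (Suc j) \<and> p \<in> S j \<and>
    (\<forall>i<j. \<bar>q (g i) - p (g i)\<bar> < (1/4)^j)}))"
  have D_cases: "f = (\<lambda>x. 0) \<or> (\<exists>q\<in>dual_ball. \<exists>p\<in>dual_ball. f = quot j (q, p) \<and>
    (\<forall>i<j. \<bar>q (g i) - p (g i)\<bar> < (1/4)^j))" if "f \<in> D j" for f j
    using that S(2) unfolding D_def by blast
  have diff: "linear (\<lambda>x. q x - p x)" "lip_le (\<lambda>x. q x - p x) 2"
    if "q \<in> dual_ball" "p \<in> dual_ball" for q p
    using that lip_le_diff[of q 1 p 1] by (auto simp: dual_ball_def intro: linear_compose_sub)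
  have N: "N j q p \<ge> (1/2)^j" "N j q p > 0" "lip (\<lambda>x. q x - p x) \<le> N j q p"
    if "q \<in> dual_ball" "p \<in> dual_ball" for q p j
    using lip_nonneg[OF diff(2)[OF that]] by (auto simp: N_def add_nonneg_pos)
  have finD: "finite (D j)" for j
  proof -
    have "finite {(q, p). q \<in> S (Suc j) \<and> p \<in> S j \<and> (\<forall>i<j. \<bar>q (g i) - p (g i)\<bar> < (1/4)^j)}"
      by (rule finite_subset[of _ "S (Suc j) \<times> S j"]) (use S(1) in auto)
    then show ?thesis by (simp add: D_def)
  qed
  have linD: "linear f" if "f \<in> D j" for f j
    using D_cases[OF that]
  proof (elim disjE bexE conjE)
    fix q p assume qp: "q \<in> dual_ball" "p \<in> dual_ball" "f = quot j (q, p)"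
    have "f = (\<lambda>x. (1 / N j q p) *\<^sub>R (q x - p x))" by (simp add: qp(3) quot_def)
    then show ?thesis using diff(1)[OF qp(1,2)] linear_compose_scale_right by blast
  qed (simp add: linear_iff)
  have boundD: "\<bar>f x\<bar> \<le> K * norm x" if "f \<in> D j" for f j x
    using D_cases[OF that]
  proof (elim disjE bexE conjE)
    fix q p assume qp: "q \<in> dual_ball" "p \<in> dual_ball" "f = quot j (q, p)"
    have "\<bar>q x - p x\<bar> \<le> lip (\<lambda>x. q x - p x) * K * norm x"
      using diff[OF qp(1,2)] by (intro functional_bound) (auto intro: lip_le_lip lip_nonneg)
    also have "\<dots> \<le> N j q p * K * norm x" using N(3)[OF qp(1,2)] K0 by (intro mult_right_mono) auto
    finally show ?thesis using N(2)[OF qp(1,2), of j]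
      by (simp add: qp(3) quot_def abs_divide divide_le_eq mult.commute mult.left_commute)
  qed (use K0 in simp)
  have smallD: "\<bar>f (g i)\<bar> \<le> (1/2)^j" if "f \<in> D j" "i < j" for f j i
    using D_cases[OF that(1)]
  proof (elim disjE bexE conjE)
    fix q p assume qp: "q \<in> dual_ball" "p \<in> dual_ball" "f = quot j (q, p)"
      and "\<forall>i<j. \<bar>q (g i) - p (g i)\<bar> < (1/4)^j"
    then have "\<bar>q (g i) - p (g i)\<bar> \<le> (1/4)^j" using that by (auto intro: less_imp_le)
    also have "(1/4::real)^j = (1/2)^j * (1/2)^j" by (simp flip: power_mult_distrib)
    also have "\<dots> \<le> (1/2)^j * N j q p" using N(1)[OF qp(1,2)] by (intro mult_left_mono) auto
    finally show ?thesis using N(2)[OF qp(1,2), of j]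
      by (simp add: qp(3) quot_def abs_divide divide_le_eq)
  qed simp
  have null: "\<exists>J. \<forall>j\<ge>J. \<forall>f\<in>D j. \<bar>f x\<bar> < e" if e: "e > 0" for x e
  proof -
    have "e / (2 * K) > 0" using e K0 by simp
    then obtain i where i: "norm (x - g i) < e / (2 * K)" using dense by blast
    obtain J where J: "(1/2::real)^J < e / 2" using real_arch_pow_inv[of "e/2" "1/2"] e by auto
    have "\<bar>f x\<bar> < e" if j: "j \<ge> max J (Suc i)" and f: "f \<in> D j" for j f
    proof -
      have "\<bar>f (x - g i)\<bar> \<le> K * norm (x - g i)" by (rule boundD[OF f])
      also have "\<dots> < e / 2" using i K0 by (simp add: field_simps)
      finally have "\<bar>f x - f (g i)\<bar> < e / 2" by (simp add: linear_diff[OF linD[OF f]])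
      moreover have "\<bar>f (g i)\<bar> \<le> (1/2)^j" using smallD f j by simp
      moreover have "(1/2::real)^j \<le> (1/2)^J" using j by (intro power_decreasing) auto
      ultimately show ?thesis using J by linarith
    qed
    then show ?thesis by blast
  qed
  \<comment> \<open>This is c (1 + 2) + 2, from \<open>lip f \<le> 1\<close> and the bound 2 on the
    geometric sum.\<close>
  define C where "C = 3 * c + 2"
  have norming: "norm x \<le> K * C * R" if "\<forall>j. \<forall>f\<in>D j. \<bar>f x\<bar> \<le> R" for x R
  proof -
    have R: "\<bar>f x\<bar> \<le> R" if "f \<in> D j" for j f
      using \<open>\<forall>j. \<forall>f\<in>D j. \<bar>f x\<bar> \<le> R\<close> that by blast
    have R0: "R \<ge> 0" using R[of "\<lambda>x. 0" 0] by (simp add: D_def)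
    define h where "h = (\<lambda>J. \<Sum>j<J. (1/2::real)^j)"
    have h2: "h J \<le> 2" for J by (simp add: h_def geometric_sum)
    \<comment> \<open>Each step down costs \<open>R\<close> times the denominator, which additivity
      bounds by c times \<open>lip f - lip p\<close> plus geometric terms; these differences
      telescope.\<close>
    have chain: "\<bar>f x\<bar> \<le> R * (c * (lip f + h J) + h J)" if "f \<in> S J" for J f
      using that
    proof (induction J arbitrary: f)
      case 0
      then show ?case by (simp add: S(3) lip_zero h_def)
    next
      case (Suc J)
      then have f: "f \<in> dual_ball" using S(2) by blast
      obtain p where p: "p \<in> S J" "\<forall>i<J. \<bar>f (g i) - p (g i)\<bar> < (1/4)^J"
        "lip p + lip (\<lambda>x. f x - p x) / c - (1/2)^J \<le> lip f"
        using cover[OF f] by blast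
      have pd: "p \<in> dual_ball" using p(1) S(2) by blast
      have "quot J (f, p) \<in> D J" using p Suc.prems by (auto simp: D_def)
      from R[OF this] have "\<bar>(f x - p x) / N J f p\<bar> \<le> R" by (simp add: quot_def)
      then have "\<bar>f x - p x\<bar> \<le> R * N J f p"
        using N(2)[OF f pd, of J] by (simp add: abs_divide divide_le_eq)
      also have "N J f p \<le> c * (lip f - lip p + (1/2)^J) + (1/2)^J"
      proof -
        have "lip (\<lambda>x. f x - p x) / c \<le> lip f - lip p + (1/2)^J" using p(3) by linarith
        then have "lip (\<lambda>x. f x - p x) \<le> (lip f - lip p + (1/2)^J) * c"
          using c by (subst (asm) pos_divide_le_eq) auto
        then show ?thesis by (simp only: N_def mult.commute add_right_mono)
      qed
      finally have "\<bar>f x - p x\<bar> \<le> R * (c * (lip f - lip p + (1/2)^J) + (1/2)^J)"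
        using R0 by (simp add: mult_left_mono)
      moreover have "\<bar>p x\<bar> \<le> R * (c * (lip p + h J) + h J)" by (rule Suc.IH[OF p(1)])
      moreover have "h (Suc J) = h J + (1/2)^J" by (simp add: h_def)
      ultimately show ?case by (simp add: algebra_simps)
    qed
    have chain': "\<bar>f x\<bar> \<le> C * R" if f: "f \<in> S J" for J f
    proof -
      have fd: "f \<in> dual_ball" using f S(2) by blast
      then have "lip f \<le> 1" by (auto simp: dual_ball_def intro: lip_least)
      then have "c * (lip f + h J) + h J \<le> c * (1 + 2) + 2"
        using h2[of J] c by (intro add_mono mult_left_mono) auto
      also have "\<dots> = C" by (simp add: C_def)
      finally have "R * (c * (lip f + h J) + h J) \<le> R * C" using R0 by (intro mult_left_mono)
      then show ?thesis using chain[OF f] by (simp add: mult.commute)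
    qed
    \<comment> \<open>Elements of \<open>S J\<close> approximate \<open>f\<close> at
      \<open>x\<close> itself, through a nearby dense point among the first J.\<close>
    have ball: "\<bar>f x\<bar> \<le> C * R" if f: "f \<in> dual_ball" for f
    proof (rule field_le_epsilon)
      fix e :: real assume e: "e > 0"
      then have "e / (4 * K) > 0" using K0 by simp
      then obtain i where i: "norm (x - g i) < e / (4 * K)" using dense by blast
      obtain J0 where J0: "(1/4::real)^J0 < e / 2" using real_arch_pow_inv[of "e/2" "1/4"] e by auto
      define J where "J = max J0 (Suc i)"
      obtain p where p: "p \<in> S J" "\<forall>i<J. \<bar>f (g i) - p (g i)\<bar> < (1/4)^J" using cover[OF f] by blast
      have pd: "p \<in> dual_ball" using p(1) S(2) by blast
      have "\<bar>f (x - g i) - p (x - g i)\<bar> \<le> 2 * K * norm (x - g i)"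
        using functional_bound[OF diff(2,1)[OF f pd]] by simp
      also have "\<dots> < e / 2" using i K0 by (simp add: field_simps)
      finally have "\<bar>(f x - p x) - (f (g i) - p (g i))\<bar> < e / 2"
        using f pd by (simp add: dual_ball_def linear_diff algebra_simps)
      moreover have "\<bar>f (g i) - p (g i)\<bar> < (1/4)^J" using p(2) by (simp add: J_def)
      moreover have "(1/4::real)^J \<le> (1/4)^J0" by (intro power_decreasing) (auto simp: J_def)
      ultimately show "\<bar>f x\<bar> \<le> C * R + e" using J0 chain'[OF p(1)] by linarith
    qed
    obtain f where f: "linear f" "\<And>y. \<bar>f y\<bar> \<le> norm y" "f x = norm x"
      using norming_functional by blast
    \<comment> \<open>A functional of norm 1 has \<open>lip\<close> at most \<open>K\<close>; this
      is the factor \<open>K\<close> in front of \<open>C\<close>.\<close>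
    have "(\<lambda>y. f y / K) \<in> dual_ball"
    proof -
      have "\<bar>f (U y) / K - f (U y') / K\<bar> \<le> 1 * nrm (y - y')" for y y'
      proof -
        have "\<bar>f (U y - U y')\<bar> \<le> K * nrm (y - y')" using f(2) U_lipschitz order_trans by blast
        then show ?thesis using K0
          by (simp add: linear_diff[OF f(1)] divide_le_eq mult.commute flip: diff_divide_distrib)
      qed
      moreover have "linear (\<lambda>y. f y / K)"
        using linear_compose_scale_right[OF f(1), of "1 / K"] by (simp add: divide_inverse mult.commute)
      ultimately show ?thesis by (simp add: dual_ball_def lip_le_def)
    qed
    from ball[OF this] show ?thesis using K0 f(3) by (simp add: divide_le_eq mult.commute mult.left_commute)
  qed
  have KC: "K * C > 0" using K0 c by (simp add: C_def)
  have neD: "D j \<noteq> {}" for j by (simp add: D_def)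
  show thesis by (rule that[of D "K * C"]) (fact finD neD linD boundD null KC norming)+
qed

theorem isomorphic_to_subspace_of_c0:
  assumes nontriv: "\<exists>y::'b. y \<noteq> 0"
  shows "isomorphic_to_subspace_of_c0 TYPE('a)"
proof (rule weak_star_null_norming_sets[OF nontriv])
  fix D :: "nat \<Rightarrow> ('a \<Rightarrow> real) set" and C :: real
  assume D: "\<And>j. finite (D j)" "\<And>j. D j \<noteq> {}" "\<And>j f. f \<in> D j \<Longrightarrow> linear f"
    "\<And>j f x. f \<in> D j \<Longrightarrow> \<bar>f x\<bar> \<le> K * norm x"
    "\<And>x e. e > 0 \<Longrightarrow> \<exists>J. \<forall>j\<ge>J. \<forall>f\<in>D j. \<bar>f x\<bar> < e"
    and C: "C > 0" "\<And>x R. \<forall>j. \<forall>f\<in>D j. \<bar>f x\<bar> \<le> R \<Longrightarrow> norm x \<le> C * R"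
  obtain g :: "nat \<Rightarrow> 'a \<Rightarrow> real" where g: "range g = (\<Union>j. D j)" "\<And>x. (\<lambda>n. g n x) \<longlonglongrightarrow> 0"
    using sequence_of_finite_sets[of D, OF D(1,2,5)] by blast
  have gD: "\<exists>j. g n \<in> D j" for n using g(1) by blast
  have lin: "linear (g n)" and bound: "\<bar>g n x\<bar> \<le> K * norm x" for n x using gD[of n] D(3,4) by blast+
  have upper: "c0_norm (\<lambda>n. g n x) \<le> K * norm x" for x
    unfolding c0_norm_def using bound by (intro cSUP_least) auto
  have lower: "norm x \<le> C * c0_norm (\<lambda>n. g n x)" for x
  proof (intro C(2) allI ballI)
    fix j f assume "f \<in> D j"
    then obtain n where "f = g n" using g(1) by blast
    then show "\<bar>f x\<bar> \<le> c0_norm (\<lambda>n. g n x)"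
      unfolding c0_norm_def using bound by (auto intro!: cSUP_upper bdd_aboveI2)
  qed
  have "c0_embedding (\<lambda>x n. g n x)"
    unfolding c0_embedding_def
  proof (intro conjI exI allI)
    show "0 < 1 / C" "0 < K" using C K by auto
    show "1 / C * norm x \<le> c0_norm (\<lambda>n. g n x)" for x
      using lower[of x] C(1) by (simp add: divide_le_eq mult.commute)
  qed (use g(2) upper in \<open>auto simp: c0_def linear_add[OF lin] linear_cmul[OF lin]\<close>)
  then show ?thesis unfolding isomorphic_to_subspace_of_c0_def by blast
qed

end

section \<open>Choice of a common Lipschitz constant, and the zero space\<close>

theorem theorem2p1:
  fixes U :: "'b::banach \<Rightarrow> 'a::banach"
  assumes "bij U"
    and "\<exists>C. C-lipschitz_on UNIV U"
    and "\<exists>D. D-lipschitz_on UNIV (inv U)"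
    and "isomorphic_to_subspace_of_c0 TYPE('b)"
  shows "isomorphic_to_subspace_of_c0 TYPE('a)"
proof (cases "\<exists>y::'b. y \<noteq> 0")
  case True
  obtain T :: "'b \<Rightarrow> nat \<Rightarrow> real" where T: "c0_embedding T"
    using assms(4) by (auto simp: isomorphic_to_subspace_of_c0_def)
  interpret c0_subspace T by standard (rule T)
  obtain C D where C: "C-lipschitz_on UNIV U" and D: "D-lipschitz_on UNIV (inv U)"
    using assms(2,3) by blast
  obtain a b where ab: "0 < a" "0 < b" "\<And>y. a * norm y \<le> nrm y" "\<And>y. nrm y \<le> b * norm y"
    using nrm_bounds by blast
  \<comment> \<open>C / a and b D are the Lipschitz constants of \<open>U\<close> and its inverse
    once Y carries \<open>nrm\<close>.\<close>
  define K where "K = max 1 (max (C / a) (b * D))"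
  have "lipschitz_to_c0_subspace T U (inv U) K"
  proof
    fix y y' x x'
    show "U (inv U x) = x" "inv U (U y) = y"
      using assms(1) by (auto simp: bij_is_surj surj_f_inv_f bij_is_inj)
    show "1 \<le> K" by (simp add: K_def)
    have "norm (U y - U y') \<le> C * norm (y - y')"
      using lipschitz_onD[OF C, of y y'] by (simp add: dist_norm)
    also have "\<dots> \<le> C * (nrm (y - y') / a)"
      using ab(1,3) lipschitz_on_nonneg[OF C] by (intro mult_left_mono) (auto simp: field_simps)
    also have "\<dots> = (C / a) * nrm (y - y')" by simp
    also have "\<dots> \<le> K * nrm (y - y')" by (intro mult_right_mono) (auto simp: K_def)
    finally show "norm (U y - U y') \<le> K * nrm (y - y')" .
    have "nrm (inv U x - inv U x') \<le> b * norm (inv U x - inv U x')" by (rule ab(4))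
    also have "\<dots> \<le> b * (D * norm (x - x'))"
      using lipschitz_onD[OF D, of x x'] ab(2) by (intro mult_left_mono) (auto simp: dist_norm)
    also have "\<dots> = (b * D) * norm (x - x')" by simp
    also have "\<dots> \<le> K * norm (x - x')" by (intro mult_right_mono) (auto simp: K_def)
    finally show "nrm (inv U x - inv U x') \<le> K * norm (x - x')" .
  qed
  then show ?thesis using True by (rule lipschitz_to_c0_subspace.isomorphic_to_subspace_of_c0)
next
  case False
  \<comment> \<open>If Y is zero there are no distinct points to norm a functional, but surjectivity
    of \<open>U\<close> makes X zero too.\<close>
  then have "x = U 0" for x :: 'a
    using assms(1) by (metis bij_is_surj surj_f_inv_f)
  then have triv: "x = 0" for x :: 'a by metis
  have "c0_embedding (\<lambda>(x::'a) (n::nat). 0::real)"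
    unfolding c0_embedding_def c0_def c0_norm_def
    by (auto simp: triv intro!: exI[of _ "1::real"])
  then show ?thesis unfolding isomorphic_to_subspace_of_c0_def by blast
qed

end
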